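(* Let $\mathcal{H}_0$ be the class of $2$-edge extremal minimal bipartite matching covered graphs and $\mathcal{H}_2$ the class of $2$-vertex extremal minimal bipartite matching covered graphs. Then $\mathcal{H}_2-C_4\subset\mathcal{H}_0$.
   Context: All graphs are finite and loopless; parallel edges are allowed. For a graph $G=(V,E)$ write $n=|V|$ and $m=|E|$. A connected graph on four or more vertices is matching covered if every edge lies in some perfect matching. A matching covered graph is minimal if deleting any single edge yields a graph that is not matching covered. $V_2$ is the set of vertices of degree two and $E_2$ the set of edges both of whose ends have degree two. A minimal bipartite matching covered graph is $2$-edge extremal if $|E_2|=m-n+2$, and $2$-vertex extremal if $|V_2|=2(m-n+2)$. $\mathcal{H}_2-C_4$ denotes the class $\mathcal{H}_2$ with the $4$-cycle $C_4$ removed. Classes are regarded up to isomorphism, and $\subset$ denotes proper containment. *)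

theory Defs
  imports Main "HOL-Library.Infinite_Typeclass"
begin

text \<open>Finite loopless multigraphs: edges are abstract objects, so parallel edges are
  distinct edges with the same two-element set of ends.\<close>

record ('v, 'e) mgraph =
  verts :: "'v set"
  edges :: "'e set"
  ends  :: "'e \<Rightarrow> 'v set"

definition multigraph :: "('v, 'e) mgraph \<Rightarrow> bool" where
  "multigraph G \<longleftrightarrow> finite (verts G) \<and> finite (edges G) \<and>
     (\<forall>e\<in>edges G. ends G e \<subseteq> verts G \<and> card (ends G e) = 2)"

definition adjacent :: "('v, 'e) mgraph \<Rightarrow> ('v \<times> 'v) set" where
  "adjacent G = {(u, v). \<exists>e\<in>edges G. ends G e = {u, v}}"

definition connected_graph :: "('v, 'e) mgraph \<Rightarrow> bool" where
  "connected_graph G \<longleftrightarrow> verts G \<noteq> {} \<and>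
     (\<forall>u\<in>verts G. \<forall>v\<in>verts G. (u, v) \<in> (adjacent G)\<^sup>*)"

definition bipartite :: "('v, 'e) mgraph \<Rightarrow> bool" where
  "bipartite G \<longleftrightarrow> (\<exists>A B. A \<union> B = verts G \<and> A \<inter> B = {} \<and>
     (\<forall>e\<in>edges G. \<exists>a\<in>A. \<exists>b\<in>B. ends G e = {a, b}))"

definition perfect_matching :: "('v, 'e) mgraph \<Rightarrow> 'e set \<Rightarrow> bool" where
  "perfect_matching G M \<longleftrightarrow> M \<subseteq> edges G \<and> (\<forall>v\<in>verts G. \<exists>!e. e \<in> M \<and> v \<in> ends G e)"

definition matching_covered :: "('v, 'e) mgraph \<Rightarrow> bool" where
  "matching_covered G \<longleftrightarrow> multigraph G \<and> connected_graph G \<and> 4 \<le> card (verts G) \<and>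
     (\<forall>e\<in>edges G. \<exists>M. perfect_matching G M \<and> e \<in> M)"

definition delete_edge :: "('v, 'e) mgraph \<Rightarrow> 'e \<Rightarrow> ('v, 'e) mgraph" where
  "delete_edge G e = G\<lparr>edges := edges G - {e}\<rparr>"

definition minimal_matching_covered :: "('v, 'e) mgraph \<Rightarrow> bool" where
  "minimal_matching_covered G \<longleftrightarrow> matching_covered G \<and>
     (\<forall>e\<in>edges G. \<not> matching_covered (delete_edge G e))"

text \<open>Since there are no loops, the degree is the number of incident edges.\<close>

definition degree :: "('v, 'e) mgraph \<Rightarrow> 'v \<Rightarrow> nat" where
  "degree G v = card {e \<in> edges G. v \<in> ends G e}"

definition V2 :: "('v, 'e) mgraph \<Rightarrow> 'v set" where
  "V2 G = {v \<in> verts G. degree G v = 2}"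

definition E2 :: "('v, 'e) mgraph \<Rightarrow> 'e set" where
  "E2 G = {e \<in> edges G. \<forall>v\<in>ends G e. degree G v = 2}"

text \<open>The number \<open>m - n + 2\<close>, as an integer to avoid truncated subtraction.\<close>

definition mn2 :: "('v, 'e) mgraph \<Rightarrow> int" where
  "mn2 G = int (card (edges G)) - int (card (verts G)) + 2"

text \<open>Both classes are closed under isomorphism. When \<open>'v\<close> and \<open>'e\<close> are infinite,
  every finite multigraph has an isomorphic copy of type \<open>('v, 'e) mgraph\<close>, so inclusions
  between these sets are inclusions between the classes up to isomorphism.\<close>

definition H0 :: "('v, 'e) mgraph set" where
  "H0 = {G. minimal_matching_covered G \<and> bipartite G \<and> int (card (E2 G)) = mn2 G}"

definition H2 :: "('v, 'e) mgraph set" where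
  "H2 = {G. minimal_matching_covered G \<and> bipartite G \<and> int (card (V2 G)) = 2 * mn2 G}"

definition isomorphic :: "('v, 'e) mgraph \<Rightarrow> ('w, 'f) mgraph \<Rightarrow> bool" where
  "isomorphic G H \<longleftrightarrow> (\<exists>f g. bij_betw f (verts G) (verts H) \<and> bij_betw g (edges G) (edges H) \<and>
     (\<forall>e\<in>edges G. ends H (g e) = f ` ends G e))"

definition C4 :: "(nat, nat) mgraph" where
  "C4 = \<lparr>verts = {0..<4}, edges = {0..<4}, ends = (\<lambda>i. {i, (i + 1) mod 4})\<rparr>"

end

theory Submission
  imports Defs
begin

text \<open>
  A bipartite graph with colour classes \<open>A\<close>, \<open>B\<close> is matching covered iff \<open>|A| = |B|\<close> and every
  proper nonempty subset of \<open>A\<close> has at least one neighbour more than it has elements. In a minimal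
  graph every edge \<open>e\<close> therefore has a tight pair \<open>(X, Y)\<close>: \<open>|X| = |Y|\<close>, and \<open>e\<close> is the only
  edge from \<open>X\<close> to \<open>B - Y\<close>. By submodularity, at a vertex of degree at least three the far sides of
  the tight pairs of two different edges are disjoint. Hence the edges joining two vertices of degree
  at least three form a forest.

  Let \<open>k = m - n + 2\<close> and assume that the graph is not a cycle. Contracting a vertex of degree two
  with its neighbours, when these both have degree at least three or both have degree two, keeps the
  graph minimal, does not change \<open>k\<close> and lowers the number of vertices of degree two. When no such
  vertex is left, the edges in \<open>E\<^sub>2\<close> match the vertices of degree two perfectly. The forest is then
  disconnected: otherwise the tight pair of the edge at a leaf \<open>a\<close> contains no further vertex of degree
  at least three, which is incompatible with the degree of \<open>a\<close>. Counting edges gives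
  \<open>|E\<^sub>2| \<ge> k\<close>. So \<open>|V\<^sub>2| \<ge> 2 k\<close> always, and equality forces the graph to be irreducible
  with \<open>|E\<^sub>2| = k\<close>. The only cycle with \<open>|V\<^sub>2| = 2 k = 4\<close> is the 4-cycle.
\<close>

section \<open>Tight pairs\<close>

definition deg :: "'e set \<Rightarrow> ('e \<Rightarrow> 'v) \<Rightarrow> 'v \<Rightarrow> nat" where
  "deg E f v = card {e \<in> E. f e = v}"

definition leaving :: "'e set \<Rightarrow> ('e \<Rightarrow> 'a) \<Rightarrow> ('e \<Rightarrow> 'b) \<Rightarrow> 'a set \<Rightarrow> 'b set \<Rightarrow> 'e set" where
  "leaving E l r X Y = {e \<in> E. l e \<in> X \<and> r e \<notin> Y}"

text \<open>Without \<open>e\<close> all edges at \<open>X\<close> end in \<open>Y\<close>, so a perfect matching would match \<open>X\<close> with \<open>Y\<close>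
  and use no edge between \<open>A - X\<close> and \<open>Y\<close>: a tight pair certifies that \<open>e\<close> cannot be deleted.\<close>

definition tight ::
    "'a set \<Rightarrow> 'b set \<Rightarrow> 'e set \<Rightarrow> ('e \<Rightarrow> 'a) \<Rightarrow> ('e \<Rightarrow> 'b) \<Rightarrow> 'e \<Rightarrow> 'a set \<Rightarrow> 'b set \<Rightarrow> bool" where
  "tight A B E l r e X Y \<longleftrightarrow>
     X \<subseteq> A \<and> Y \<subseteq> B \<and> card X = card Y \<and> leaving E l r X Y = {e}"

text \<open>Letting \<open>Y\<close> be any set that catches the edges from \<open>X\<close>, not
  just the neighbourhood of \<open>X\<close>, makes \<open>surplus\<close> stable under complements.
  For \<open>X = A\<close> it says that no vertex of \<open>B\<close> is isolated.\<close>

locale elementary =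
  fixes A :: "'a set" and B :: "'b set" and E :: "'e set" and l :: "'e \<Rightarrow> 'a" and r :: "'e \<Rightarrow> 'b"
  assumes finite_A: "finite A" and finite_B: "finite B" and finite_E: "finite E"
    and l_in: "e \<in> E \<Longrightarrow> l e \<in> A" and r_in: "e \<in> E \<Longrightarrow> r e \<in> B"
    and card_eq: "card A = card B" and card_ge: "2 \<le> card A"
    and surplus: "\<lbrakk>X \<subseteq> A; Y \<subseteq> B; X \<noteq> {}; Y \<noteq> B; leaving E l r X Y = {}\<rbrakk> \<Longrightarrow> card X < card Y"

locale minimal_elementary = elementary +
  assumes critical: "e \<in> E \<Longrightarrow> \<exists>X Y. tight A B E l r e X Y"

text \<open>Complementing both sides reverses the direction in which edges are read. Through this,
  results about \<open>A\<close> transfer to \<open>B\<close>.\<close>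

lemma leaving_swap:
  assumes "\<And>e. e \<in> E \<Longrightarrow> l e \<in> A" "\<And>e. e \<in> E \<Longrightarrow> r e \<in> B" "X \<subseteq> B" "Y \<subseteq> A"
  shows "leaving E l r (A - Y) (B - X) = leaving E r l X Y"
  using assms unfolding leaving_def by auto

lemma elementary_swap:
  assumes "elementary A B E l r"
  shows "elementary B A E r l"
proof -
  interpret elementary A B E l r by fact
  show ?thesis
  proof unfold_locales
    fix X Y assume XY: "X \<subseteq> B" "Y \<subseteq> A" "X \<noteq> {}" "Y \<noteq> A" "leaving E r l X Y = {}"
    have "leaving E l r (A - Y) (B - X) = {}"
      using XY leaving_swap[of E l A r B X Y] l_in r_in by simp
    moreover have "A - Y \<noteq> {}" "B - X \<noteq> B" using XY by auto
    ultimately have "card (A - Y) < card (B - X)" using surplus[of "A - Y" "B - X"] by auto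
    moreover have "card (A - Y) = card A - card Y" "card (B - X) = card B - card X"
      using XY finite_A finite_B by (auto simp: card_Diff_subset finite_subset)
    moreover have "card X \<le> card B" "card Y \<le> card A"
      using XY finite_A finite_B by (auto intro: card_mono)
    ultimately show "card X < card Y" using card_eq by linarith
  qed (use finite_A finite_B finite_E l_in r_in card_eq card_ge in auto)
qed

lemma tight_swap:
  assumes "elementary A B E l r" "tight A B E l r e X Y"
  shows "tight B A E r l e (B - Y) (A - X)"
proof -
  interpret elementary A B E l r by fact
  have XY: "X \<subseteq> A" "Y \<subseteq> B" "card X = card Y" "leaving E l r X Y = {e}"
    using assms(2) by (auto simp: tight_def)
  have "leaving E r l (B - Y) (A - X) = leaving E l r X Y"
    using XY leaving_swap[of E r B l A X Y] l_in r_in by simp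
  moreover have "card (B - Y) = card (A - X)"
    using XY finite_A finite_B card_eq by (auto simp: card_Diff_subset finite_subset)
  ultimately show ?thesis using XY by (auto simp: tight_def)
qed

lemma minimal_elementary_swap:
  assumes "minimal_elementary A B E l r"
  shows "minimal_elementary B A E r l"
proof -
  interpret minimal_elementary A B E l r by fact
  have el: "elementary A B E l r" by unfold_locales
  interpret s: elementary B A E r l by (rule elementary_swap[OF el])
  show ?thesis
    using critical tight_swap[OF el] by unfold_locales blast
qed

context elementary
begin

text \<open>The neighbourhood of \<open>a\<close> is either all of \<open>B\<close>, which has at
  least two elements, or larger than \<open>{a}\<close> by \<open>surplus\<close>.\<close>

lemma deg_l_ge_2:
  assumes "a \<in> A" shows "2 \<le> deg E l a"
proof -
  let ?Y = "r ` {e \<in> E. l e = a}"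
  have le: "card ?Y \<le> deg E l a" unfolding deg_def using finite_E by (auto intro: card_image_le)
  show ?thesis
  proof (cases "?Y = B")
    case True
    then show ?thesis using le card_eq card_ge by simp
  next
    case False
    have "card {a} < card ?Y"
      using surplus[of "{a}" ?Y] False assms r_in by (fastforce simp: leaving_def)
    then show ?thesis using le by simp
  qed
qed

lemma deg_r_ge_2: "b \<in> B \<Longrightarrow> 2 \<le> deg E r b"
proof -
  interpret s: elementary B A E r l by (rule elementary_swap) unfold_locales
  show "b \<in> B \<Longrightarrow> 2 \<le> deg E r b" by (rule s.deg_l_ge_2)
qed

lemma card_E_l: "card E = (\<Sum>a\<in>A. deg E l a)"
proof -
  have "E = (\<Union>a\<in>A. {e \<in> E. l e = a})" using l_in by auto
  then have "card E = card (\<Union>a\<in>A. {e \<in> E. l e = a})" by simp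
  also have "\<dots> = (\<Sum>a\<in>A. card {e \<in> E. l e = a})"
    using finite_A finite_E by (intro card_UN_disjoint) auto
  finally show ?thesis by (simp add: deg_def)
qed

text \<open>Adding the right ends of the leaving edges to \<open>Y\<close> gives a pair that no edge
  leaves, so \<open>surplus\<close> applies unless this exhausts \<open>B\<close>. Then either
  \<open>X\<close> is smaller than \<open>A\<close>, or \<open>X = A\<close> and two leaving edges
  share an end \<open>b\<close> outside \<open>Y\<close>, which saves one in the count.\<close>

lemma card_lt_leaving:
  assumes XY: "X \<subseteq> A" "Y \<subseteq> B" "X \<noteq> {}" "Y \<noteq> B"
  shows "card X < card Y + card (leaving E l r X Y)"
proof -
  let ?L = "leaving E l r X Y"
  let ?Z = "Y \<union> r ` ?L"
  have finL: "finite ?L" using finite_E by (simp add: leaving_def)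
  have Z: "?Z \<subseteq> B" using XY r_in by (auto simp: leaving_def)
  have cZ: "card ?Z \<le> card Y + card ?L"
    using card_Un_le[of Y "r ` ?L"] card_image_le[OF finL, of r] by linarith
  show ?thesis
  proof (cases "?Z = B")
    case False
    have "leaving E l r X ?Z = {}" by (auto simp: leaving_def)
    then have "card X < card ?Z" using surplus[of X ?Z] XY Z False by auto
    then show ?thesis using cZ by linarith
  next
    case True
    show ?thesis
    proof (cases "X = A")
      case False
      then have "card X < card A" using XY finite_A by (simp add: psubset_card_mono psubset_eq)
      then show ?thesis using cZ True card_eq by simp
    next
      case XA: True
      obtain b where b: "b \<in> B" "b \<notin> Y" using XY by auto
      let ?Lb = "{e \<in> E. r e = b}"
      have sub: "?Lb \<subseteq> ?L" using XA b l_in by (auto simp: leaving_def)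
      have "B \<subseteq> Y \<union> insert b (r ` (?L - ?Lb))" using True by auto
      then have "card B \<le> card (Y \<union> insert b (r ` (?L - ?Lb)))"
        using finL XY finite_B by (intro card_mono) (auto intro: finite_subset)
      also have "\<dots> \<le> card Y + card (insert b (r ` (?L - ?Lb)))" by (rule card_Un_le)
      also have "card (insert b (r ` (?L - ?Lb))) \<le> Suc (card (r ` (?L - ?Lb)))"
        by (rule card_insert_le_m1) auto
      also have "card (r ` (?L - ?Lb)) \<le> card (?L - ?Lb)" using finL by (intro card_image_le) auto
      also have "card (?L - ?Lb) = card ?L - card ?Lb"
        using sub finL finite_E by (intro card_Diff_subset) auto
      finally have "card B \<le> card Y + Suc (card ?L - card ?Lb)" by simp
      moreover have "2 \<le> card ?Lb" using deg_r_ge_2[OF b(1)] by (simp add: deg_def)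
      moreover have "card ?Lb \<le> card ?L" using sub finL by (rule card_mono[rotated])
      ultimately show ?thesis using XA card_eq by simp
    qed
  qed
qed

text \<open>Submodularity: no edge leaves the union of the two pairs, as each of \<open>e\<close>
  and \<open>h\<close> ends in the right side of the other. So if the union does not exhaust
  \<open>B\<close>, its surplus makes \<open>X \<inter> X'\<close> larger than
  \<open>Y \<inter> Y'\<close>, which the degree of \<open>l e\<close> excludes.\<close>

lemma tight_at_l:
  assumes e: "tight A B E l r e X Y" and h: "tight A B E l r h X' Y'"
    and ne: "e \<noteq> h" and at: "l e = l h" and deg: "3 \<le> deg E l (l e)"
  shows "X \<union> X' = A" "Y \<union> Y' = B"
proof -
  let ?a = "l e"
  have XY: "X \<subseteq> A" "Y \<subseteq> B" "card X = card Y" and XY': "X' \<subseteq> A" "Y' \<subseteq> B" "card X' = card Y'"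
    using e h by (auto simp: tight_def)
  have e_iff: "\<And>g. g \<in> E \<and> l g \<in> X \<and> r g \<notin> Y \<longleftrightarrow> g = e"
    using e by (auto simp: tight_def leaving_def)
  have h_iff: "\<And>g. g \<in> E \<and> l g \<in> X' \<and> r g \<notin> Y' \<longleftrightarrow> g = h"
    using h by (auto simp: tight_def leaving_def)
  have fin: "finite X" "finite Y" "finite X'" "finite Y'"
    using XY XY' finite_A finite_B by (auto intro: finite_subset)
  have a: "?a \<in> X" "?a \<in> X'" "?a \<in> A" and eE: "e \<in> E" and re: "r e \<notin> Y" "r e \<in> B"
    using e_iff[of e] h_iff[of h] at l_in r_in by auto
  have sums: "card (X \<union> X') + card (X \<inter> X') = card (Y \<union> Y') + card (Y \<inter> Y')"
    using card_Un_Int[OF fin(1,3)] card_Un_Int[OF fin(2,4)] XY XY' by linarith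
  have small: "card (X \<inter> X') \<le> card (Y \<inter> Y')"
  proof (rule ccontr)
    assume big: "\<not> ?thesis"
    show False
    \<comment> \<open>Only \<open>e\<close> and \<open>h\<close> can leave the intersection.
      Dropping their common end gives a pair that no edge leaves, whose surplus contradicts
      \<open>big\<close>; if the intersection has no other vertex, \<open>e\<close> and
      \<open>h\<close> are the only edges at \<open>?a\<close>.\<close>
    proof (cases "X \<inter> X' - {?a} = {}")
      case False
      have "g \<notin> leaving E l r (X \<inter> X' - {?a}) (Y \<inter> Y')" for g
        unfolding leaving_def using e_iff[of g] h_iff[of g] at by auto
      then have "leaving E l r (X \<inter> X' - {?a}) (Y \<inter> Y') = {}" by blast
      then have "card (X \<inter> X' - {?a}) < card (Y \<inter> Y')"
        using surplus[of "X \<inter> X' - {?a}" "Y \<inter> Y'"] XY False re by auto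
      then show False using big fin a by (simp add: card_Diff_singleton_if)
    next
      case True
      then have "X \<inter> X' = {?a}" using a by auto
      then have "card (Y \<inter> Y') = 0" using big by simp
      then have "Y \<inter> Y' = {}" using fin by simp
      have "g = e \<or> g = h" if "g \<in> E" "l g = ?a" for g
        using e_iff[of g] h_iff[of g] a that \<open>Y \<inter> Y' = {}\<close> by auto
      then have "{g \<in> E. l g = ?a} \<subseteq> {e, h}" by blast
      then have "deg E l ?a \<le> card {e, h}" unfolding deg_def by (intro card_mono) auto
      then show False using deg ne by simp
    qed
  qed
  have "leaving E l r (X \<union> X') (Y \<union> Y') = {}"
  proof -
    have "r e \<in> Y'" using h_iff[of e] eE a ne by auto
    moreover have "r h \<in> Y" using e_iff[of h] h_iff[of h] a ne at by auto
    ultimately have "g \<notin> leaving E l r (X \<union> X') (Y \<union> Y')" for g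
      unfolding leaving_def using e_iff[of g] h_iff[of g] by auto
    then show ?thesis by blast
  qed
  then have B: "Y \<union> Y' = B"
    using surplus[of "X \<union> X'" "Y \<union> Y'"] XY XY' a sums small by (auto simp del: Un_iff)
  then have "card A \<le> card (X \<union> X')" using sums[unfolded B] small card_eq by linarith
  then have "X \<union> X' = A" using XY XY' finite_A by (intro card_seteq) auto
  with B show "X \<union> X' = A" "Y \<union> Y' = B" by auto
qed

text \<open>This is \<open>tight_at_l\<close> for the complementary pairs: unions filling a class
  become empty intersections.\<close>

lemma tight_at_r:
  assumes e: "tight A B E l r e X Y" and h: "tight A B E l r h X' Y'"
    and ne: "e \<noteq> h" and at: "r e = r h" and deg: "3 \<le> deg E r (r e)"
  shows "X \<inter> X' = {}" "Y \<inter> Y' = {}"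
proof -
  have el: "elementary A B E l r" by unfold_locales
  interpret s: elementary B A E r l by (rule elementary_swap[OF el])
  have "(B - Y) \<union> (B - Y') = B" "(A - X) \<union> (A - X') = A"
    using s.tight_at_l[OF tight_swap[OF el e] tight_swap[OF el h] ne at deg] by auto
  then show "X \<inter> X' = {}" "Y \<inter> Y' = {}" using e h by (auto simp: tight_def)
qed

text \<open>The pair is \<open>A\<close> without the other neighbour of \<open>r e\<close>, and
  \<open>B\<close> without \<open>r e\<close>. Stated for \<open>elementary\<close>, this applies to
  a contracted graph whose minimality is still to be shown.\<close>

lemma deg_2_critical:
  assumes e: "e \<in> E" and d: "deg E r (r e) = 2"
  shows "\<exists>X Y. tight A B E l r e X Y"
proof -
  let ?b = "r e"
  have "card {g \<in> E. r g = ?b} = 2" using d by (simp add: deg_def)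
  then obtain x y where xy: "{g \<in> E. r g = ?b} = {x, y}" "x \<noteq> y" by (auto simp: card_2_iff)
  have "e = x \<or> e = y" using e xy(1) by blast
  then obtain h where h: "{g \<in> E. r g = ?b} = {e, h}" "h \<noteq> e"
    using xy insert_commute[of x y "{}"] by metis
  have h_iff: "g \<in> E \<and> r g = ?b \<longleftrightarrow> g = e \<or> g = h" for g
  proof -
    have "g \<in> {g \<in> E. r g = ?b} \<longleftrightarrow> g \<in> {e, h}" by (simp only: h(1))
    then show ?thesis by simp
  qed
  have ne: "l e \<noteq> l h"
  proof
    assume eq: "l e = l h"
    have "leaving E l r (A - {l e}) (B - {?b}) = {}"
      unfolding leaving_def using h_iff eq r_in by (auto; metis)
    moreover have "A - {l e} \<noteq> {}"
    proof
      assume "A - {l e} = {}"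
      then have "card A \<le> card {l e}" by (intro card_mono) auto
      then show False using card_ge by simp
    qed
    ultimately have "card (A - {l e}) < card (B - {?b})"
      using surplus[of "A - {l e}" "B - {?b}"] r_in[OF e] by auto
    then show False using l_in[OF e] r_in[OF e] card_eq finite_A finite_B by simp
  qed
  have "leaving E l r (A - {l h}) (B - {?b}) = {e}"
    unfolding leaving_def using h_iff ne r_in l_in e by (auto; metis)
  moreover have "card (A - {l h}) = card (B - {?b})"
    using h_iff[of h] l_in r_in[OF e] card_eq finite_A finite_B by auto
  ultimately have "tight A B E l r e (A - {l h}) (B - {?b})" by (simp add: tight_def)
  then show ?thesis by blast
qed

end

context minimal_elementary
begin

text \<open>Whether an edge leaves a pair depends only on its ends, so parallel edges leave a tight
  pair together.\<close>

lemma no_parallel: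
  assumes "e \<in> E" "h \<in> E" "l e = l h" "r e = r h" shows "e = h"
proof -
  obtain X Y where "tight A B E l r e X Y" using critical assms by blast
  then have "leaving E l r X Y = {e}" by (simp add: tight_def)
  then have "e \<in> leaving E l r X Y" "leaving E l r X Y \<subseteq> {e}" by auto
  then have "h \<in> leaving E l r X Y" using assms by (auto simp: leaving_def)
  then show ?thesis using \<open>leaving E l r X Y = {e}\<close> by auto
qed

end

section \<open>Bicontraction\<close>

definition num_deg2 :: "'a set \<Rightarrow> 'b set \<Rightarrow> 'e set \<Rightarrow> ('e \<Rightarrow> 'a) \<Rightarrow> ('e \<Rightarrow> 'b) \<Rightarrow> nat" where
  "num_deg2 A B E l r = card {a \<in> A. deg E l a = 2} + card {b \<in> B. deg E r b = 2}"

definition num_edges2 :: "'e set \<Rightarrow> ('e \<Rightarrow> 'a) \<Rightarrow> ('e \<Rightarrow> 'b) \<Rightarrow> nat" where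
  "num_edges2 E l r = card {e \<in> E. deg E l (l e) = 2 \<and> deg E r (r e) = 2}"

context minimal_elementary
begin

text \<open>The vertex \<open>a\<close> and its two neighbours \<open>r e1\<close> and \<open>r e2\<close> are merged into one vertex, which
  keeps the name \<open>r e1\<close>. A tight pair survives unless it separates the two neighbours and \<open>e\<close> ends
  at one of them. If both neighbours have degree at least three this contradicts
  \<open>tight_at_r\<close>; if both have degree two then so does the merged vertex, and
  \<open>deg_2_critical\<close> applies.\<close>

lemma bicontract:
  assumes aA: "a \<in> A" and at_a: "{e \<in> E. l e = a} = {e1, e2}" and ne: "e1 \<noteq> e2"
    and degs: "(3 \<le> deg E r (r e1) \<and> 3 \<le> deg E r (r e2)) \<or> (deg E r (r e1) = 2 \<and> deg E r (r e2) = 2)"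
    and card3: "3 \<le> card A"
  defines "A' \<equiv> A - {a}" and "B' \<equiv> B - {r e2}" and "E' \<equiv> E - {e1, e2}"
    and "r' \<equiv> (\<lambda>e. if r e = r e2 then r e1 else r e)"
  shows "minimal_elementary A' B' E' l r'" "num_deg2 A' B' E' l r' < num_deg2 A B E l r"
proof -
  let ?b1 = "r e1" and ?b2 = "r e2"
  have eE: "e1 \<in> E" "e2 \<in> E" "l e1 = a" "l e2 = a" using at_a by auto
  have a_iff: "l e = a \<longleftrightarrow> e = e1 \<or> e = e2" if "e \<in> E" for e using at_a that by blast
  have b12: "?b1 \<noteq> ?b2" using no_parallel[of e1 e2] eE ne by auto
  have bB: "?b1 \<in> B" "?b2 \<in> B" using eE r_in by auto
  have la: "\<And>e. e \<in> E' \<Longrightarrow> l e \<noteq> a" using a_iff by (auto simp: E'_def)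
  have E'E: "\<And>e. e \<in> E' \<Longrightarrow> e \<in> E" by (simp add: E'_def)
  have el': "elementary A' B' E' l r'"
  proof
    fix X Y assume XY: "X \<subseteq> A'" "Y \<subseteq> B'" "X \<noteq> {}" "Y \<noteq> B'" "leaving E' l r' X Y = {}"
    have clo: "e \<in> E' \<and> l e \<in> X \<longrightarrow> r' e \<in> Y" for e using XY(5) by (auto simp: leaving_def)
    have "X \<subseteq> A" "Y \<subseteq> B" using XY(1,2) by (auto simp: A'_def B'_def)
    then have fin: "finite X" "finite Y" using finite_A finite_B by (simp_all add: finite_subset)
    have aX: "a \<notin> X" and bY: "?b2 \<notin> Y" using XY by (auto simp: A'_def B'_def)
    show "card X < card Y"
    \<comment> \<open>The contraction is undone: a pair containing the merged vertex regains
      \<open>a\<close> and \<open>?b2\<close>, one on each side; any other pair stays as it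
      is.\<close>
    proof (cases "?b1 \<in> Y")
      case True
      have "leaving E l r (insert a X) (insert ?b2 Y) = {}"
      proof -
        have "r e \<in> insert ?b2 Y" if "e \<in> E" "l e \<in> insert a X" for e
          using clo[of e] that eE True aX a_iff[of e] by (auto simp: E'_def r'_def split: if_splits)
        then show ?thesis by (auto simp: leaving_def)
      qed
      then have "card (insert a X) < card (insert ?b2 Y)"
        using surplus[of "insert a X" "insert ?b2 Y"] XY aA bB by (auto simp: A'_def B'_def)
      then show ?thesis using fin aX bY by simp
    next
      case False
      have "leaving E l r X Y = {}"
      proof -
        have "r e \<in> Y" if "e \<in> E" "l e \<in> X" for e
          using clo[of e] that eE False aX by (auto simp: E'_def r'_def split: if_splits)
        then show ?thesis by (auto simp: leaving_def)
      qed
      then show ?thesis using surplus[of X Y] XY bB bY by (auto simp: A'_def B'_def)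
    qed
  next
    show "card A' = card B'"
      using aA bB card_eq finite_A finite_B by (simp add: A'_def B'_def)
    show "2 \<le> card A'" using card3 aA finite_A by (simp add: A'_def)
  next
    fix e assume e: "e \<in> E'"
    show "l e \<in> A'" using l_in[of e] la[OF e] E'E[OF e] by (simp add: A'_def)
    show "r' e \<in> B'" using r_in[of e] E'E[OF e] b12 bB by (simp add: B'_def r'_def)
  qed (use finite_A finite_B finite_E in \<open>simp_all add: A'_def B'_def E'_def\<close>)
  interpret c: elementary A' B' E' l r' by fact
  have b1_unchanged: "deg E' r' v = deg E r v" if "v \<noteq> ?b1" "v \<noteq> ?b2" for v
  proof -
    have "{e \<in> E'. r' e = v} = {e \<in> E. r e = v}" using that by (auto simp: E'_def r'_def)
    then show ?thesis by (simp add: deg_def)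
  qed
  have deg_l: "deg E' l v = deg E l v" if "v \<noteq> a" for v
  proof -
    have "{e \<in> E'. l e = v} = {e \<in> E. l e = v}" using that eE by (auto simp: E'_def)
    then show ?thesis by (simp add: deg_def)
  qed
  have deg_b1: "deg E' r' ?b1 + 2 = deg E r ?b1 + deg E r ?b2"
  proof -
    have "{e \<in> E'. r' e = ?b1} = ({e \<in> E. r e = ?b1} - {e1}) \<union> ({e \<in> E. r e = ?b2} - {e2})"
    proof (rule set_eqI)
      fix e
      show "e \<in> {e \<in> E'. r' e = ?b1} \<longleftrightarrow> e \<in> ({e \<in> E. r e = ?b1} - {e1}) \<union> ({e \<in> E. r e = ?b2} - {e2})"
        using b12 by (cases "e = e1"; cases "e = e2"; cases "r e = ?b2") (simp_all add: E'_def r'_def)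
    qed
    moreover have "card (({e \<in> E. r e = ?b1} - {e1}) \<union> ({e \<in> E. r e = ?b2} - {e2}))
        = card ({e \<in> E. r e = ?b1} - {e1}) + card ({e \<in> E. r e = ?b2} - {e2})"
      by (rule card_Un_disjoint) (use finite_E b12 in auto)
    ultimately have "deg E' r' ?b1 = card ({e \<in> E. r e = ?b1} - {e1}) + card ({e \<in> E. r e = ?b2} - {e2})"
      by (simp only: deg_def)
    moreover have "card ({e \<in> E. r e = ?b1} - {e1}) = deg E r ?b1 - 1"
      "card ({e \<in> E. r e = ?b2} - {e2}) = deg E r ?b2 - 1"
      using eE by (auto simp: deg_def card_Diff_singleton_if)
    ultimately show ?thesis using deg_r_ge_2[OF bB(1)] deg_r_ge_2[OF bB(2)] by linarith
  qed
  have crit: "\<exists>X Y. tight A' B' E' l r' e X Y" if e: "e \<in> E'" for e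
  proof -
    obtain X Y where t: "tight A B E l r e X Y" using critical e E'E by blast
    have XY: "X \<subseteq> A" "Y \<subseteq> B" "card X = card Y" using t by (auto simp: tight_def)
    have iff: "\<And>g. g \<in> E \<and> l g \<in> X \<and> r g \<notin> Y \<longleftrightarrow> g = e"
      using t by (auto simp: tight_def leaving_def)
    have ne_e: "e1 \<noteq> e" "e2 \<noteq> e" using e by (auto simp: E'_def)
    have le: "l e \<in> X" "r e \<notin> Y" "l e \<noteq> a" using iff[of e] la e by auto
    have fin: "finite X" "finite Y" using XY finite_A finite_B by (auto intro: finite_subset)
    have clo: "r g \<in> Y" if "g \<in> E'" "l g \<in> X" "g \<noteq> e" for g
      using iff[of g] that E'E by auto
    have tightI: "tight A' B' E' l r' e X' Y'"
      if "X' \<subseteq> A'" "Y' \<subseteq> B'" "card X' = card Y'" "l e \<in> X'" "r' e \<notin> Y'"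
        "\<And>g. g \<in> E' \<Longrightarrow> l g \<in> X' \<Longrightarrow> g \<noteq> e \<Longrightarrow> r' g \<in> Y'" for X' Y'
      using that e unfolding tight_def leaving_def by blast
    show ?thesis
    proof (cases "a \<in> X")
      case True
      then have bY: "?b1 \<in> Y" "?b2 \<in> Y" using iff[of e1] iff[of e2] eE ne_e by auto
      have "tight A' B' E' l r' e (X - {a}) (Y - {?b2})"
      proof (rule tightI)
        show "card (X - {a}) = card (Y - {?b2})" using XY True bY by (simp add: card_Diff_singleton_if)
        show "r' e \<notin> Y - {?b2}" using le bY by (auto simp: r'_def)
        show "r' g \<in> Y - {?b2}" if "g \<in> E'" "l g \<in> X - {a}" "g \<noteq> e" for g
          using clo[of g] that bY b12 by (auto simp: r'_def)
      qed (use XY le in \<open>auto simp: A'_def B'_def\<close>)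
      then show ?thesis by blast
    next
      case aX: False
      have XA': "X \<subseteq> A'" using XY aX by (auto simp: A'_def)
      \<comment> \<open>Otherwise \<open>a\<close> could be added to \<open>X\<close> without
        creating a leaving edge, and one leaving edge would be too few for
        \<open>card_lt_leaving\<close>.\<close>
      have not_both: "\<not> (?b1 \<in> Y \<and> ?b2 \<in> Y)"
      proof
        assume bY: "?b1 \<in> Y \<and> ?b2 \<in> Y"
        have "leaving E l r (insert a X) Y \<subseteq> {e}"
        proof
          fix g assume "g \<in> leaving E l r (insert a X) Y"
          then have g: "g \<in> E" "l g = a \<or> l g \<in> X" "r g \<notin> Y" by (auto simp: leaving_def)
          then have "l g \<noteq> a" using a_iff bY by blast
          then show "g \<in> {e}" using iff[of g] g by auto
        qed
        then have "card (leaving E l r (insert a X) Y) \<le> 1"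
          using card_mono[of "{e}"] by fastforce
        moreover have "card (insert a X) < card Y + card (leaving E l r (insert a X) Y)"
          using card_lt_leaving[of "insert a X" Y] XY aA le r_in[of e] E'E[OF e] by auto
        ultimately show False using XY aX fin by simp
      qed
      show ?thesis
      proof (cases "?b1 \<in> Y \<or> ?b2 \<in> Y")
        case False
        have "tight A' B' E' l r' e X Y"
        proof (rule tightI)
          show "r' g \<in> Y" if "g \<in> E'" "l g \<in> X" "g \<noteq> e" for g
            using clo[OF that] False by (auto simp: r'_def)
        qed (use XY XA' le False in \<open>auto simp: B'_def r'_def\<close>)
        then show ?thesis by blast
      next
        case one: True
        show ?thesis
        proof (cases "r e = ?b1 \<or> r e = ?b2")
          case False
          \<comment> \<open>Exactly one neighbour of \<open>a\<close> lies in \<open>Y\<close>; the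
            merged vertex takes its place. Since \<open>e\<close> ends elsewhere, it still
            leaves.\<close>
          let ?Y = "insert ?b1 (Y - {?b2})"
          have "tight A' B' E' l r' e X ?Y"
          proof (rule tightI)
            show "card X = card ?Y"
            proof (cases "?b2 \<in> Y")
              case True
              then have "?b1 \<notin> Y - {?b2}" using not_both by auto
              then show ?thesis using XY True fin card_Suc_Diff1[of Y ?b2] by simp
            next
              case False
              then show ?thesis using XY one by (simp add: insert_absorb)
            qed
            show "r' g \<in> ?Y" if "g \<in> E'" "l g \<in> X" "g \<noteq> e" for g
              using clo[OF that] by (auto simp: r'_def)
          qed (use XY XA' le False b12 bB in \<open>auto simp: B'_def r'_def\<close>)
          then show ?thesis by blast
        next
          case reb: True
          then have r'e: "r' e = ?b1" by (auto simp: r'_def)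
          consider "3 \<le> deg E r ?b1" "3 \<le> deg E r ?b2" | "deg E' r' ?b1 = 2"
            using degs deg_b1 by linarith
          then show ?thesis
          proof cases
            case 2
            then show ?thesis using c.deg_2_critical[OF e] r'e by simp
          next
            case 1
            \<comment> \<open>The edge \<open>i\<close> joins \<open>a\<close> to the end of
              \<open>e\<close>. The other neighbour of \<open>a\<close> lies in \<open>Y\<close>,
              and also in \<open>Y2\<close>, since \<open>a\<close> is in \<open>X2\<close> and only
              \<open>i\<close> leaves; but \<open>Y\<close> and \<open>Y2\<close> are
              disjoint.\<close>
            obtain i where i: "i = e1 \<or> i = e2" "r e = r i" using reb by auto
            obtain X2 Y2 where t2: "tight A B E l r i X2 Y2" using critical i eE by blast
            have iff2: "\<And>g. g \<in> E \<and> l g \<in> X2 \<and> r g \<notin> Y2 \<longleftrightarrow> g = i"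
              using t2 by (auto simp: tight_def leaving_def)
            have "e \<noteq> i" using i ne_e by auto
            then have "Y \<inter> Y2 = {}" using tight_at_r[OF t t2] i 1 by auto
            moreover have "a \<in> X2" using iff2[of i] i eE by auto
            then have "?b1 \<in> Y2 \<or> i = e1" "?b2 \<in> Y2 \<or> i = e2"
              using iff2[of e1] iff2[of e2] eE by auto
            ultimately show ?thesis using one i le ne by auto
          qed
        qed
      qed
    qed
  qed
  show "minimal_elementary A' B' E' l r'"
    by unfold_locales (use crit in auto)
  have "{v \<in> A'. deg E' l v = 2} = {v \<in> A. deg E l v = 2} - {a}"
    using deg_l by (auto simp: A'_def)
  moreover have "a \<in> {v \<in> A. deg E l v = 2}" using aA at_a ne by (simp add: deg_def)
  ultimately have "card {v \<in> A'. deg E' l v = 2} < card {v \<in> A. deg E l v = 2}"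
    using finite_A by (metis (no_types, lifting) card_Diff1_less finite_Collect_conjI mem_Collect_eq finite_subset subsetI)
  moreover have "{v \<in> B'. deg E' r' v = 2} \<subseteq> {v \<in> B. deg E r v = 2}"
  proof
    fix v assume v: "v \<in> {v \<in> B'. deg E' r' v = 2}"
    then have "deg E r v = 2" using b1_unchanged[of v] deg_b1 degs by (cases "v = ?b1") (auto simp: B'_def)
    then show "v \<in> {v \<in> B. deg E r v = 2}" using v by (auto simp: B'_def)
  qed
  then have "card {v \<in> B'. deg E' r' v = 2} \<le> card {v \<in> B. deg E r v = 2}"
    using finite_B by (intro card_mono) auto
  ultimately show "num_deg2 A' B' E' l r' < num_deg2 A B E l r" by (simp add: num_deg2_def)
qed

end

section \<open>The forest of edges between vertices of large degree\<close>

text \<open>For finite edge sets this characterises forests: every nonempty subgraph has a leaf. The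
  form passes to subsets and suits induction on edges.\<close>

definition leafy :: "'e set \<Rightarrow> ('e \<Rightarrow> 'a) \<Rightarrow> ('e \<Rightarrow> 'b) \<Rightarrow> bool" where
  "leafy F l r \<longleftrightarrow> (\<forall>S\<subseteq>F. S \<noteq> {} \<longrightarrow>
     (\<exists>e\<in>S. (\<forall>g\<in>S. l g = l e \<longrightarrow> g = e) \<or> (\<forall>g\<in>S. r g = r e \<longrightarrow> g = e)))"

lemma leafy_mono:
  assumes "leafy F l r" "S \<subseteq> F"
  shows "leafy S l r"
  unfolding leafy_def
proof (intro allI impI)
  fix T assume T: "T \<subseteq> S" "T \<noteq> {}"
  have "T \<subseteq> F" using T(1) assms(2) by (rule subset_trans)
  with T(2) show "\<exists>e\<in>T. (\<forall>g\<in>T. l g = l e \<longrightarrow> g = e) \<or> (\<forall>g\<in>T. r g = r e \<longrightarrow> g = e)"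
    using assms(1)[unfolded leafy_def, rule_format, of T] by simp
qed

text \<open>A forest has fewer edges than vertices: a leaf is removed together with its edge.
  \<open>P\<close> and \<open>Q\<close> may contain isolated vertices.\<close>

lemma leafy_card:
  assumes "leafy F l r" "finite F" "finite P" "finite Q" "l ` F \<subseteq> P" "r ` F \<subseteq> Q" "P \<noteq> {} \<or> Q \<noteq> {}"
  shows "card F < card P + card Q"
  using assms
proof (induction "card F" arbitrary: F P Q rule: less_induct)
  case less
  show ?case
  proof (cases "F = {}")
    case True
    then show ?thesis using less.prems by (auto simp: card_gt_0_iff)
  next
    case False
    then obtain e where e: "e \<in> F"
      and leaf: "(\<forall>g\<in>F. l g = l e \<longrightarrow> g = e) \<or> (\<forall>g\<in>F. r g = r e \<longrightarrow> g = e)"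
      using less.prems(1) unfolding leafy_def by blast
    let ?F = "F - {e}"
    have smaller: "card ?F < card F" "card F = Suc (card ?F)"
      using card_Diff1_less[OF less.prems(2) e] card_Suc_Diff1[OF less.prems(2) e] by simp_all
    have lf: "leafy ?F l r" "finite ?F" using less.prems leafy_mono[of F l r ?F] by auto
    have ends: "l e \<in> P" "r e \<in> Q" using e less.prems by auto
    from leaf show ?thesis
    proof
      assume "\<forall>g\<in>F. l g = l e \<longrightarrow> g = e"
      then have "card ?F < card (P - {l e}) + card Q"
        by (intro less.hyps[OF smaller(1) lf]) (use less.prems ends in auto)
      moreover have "card P = Suc (card (P - {l e}))"
        using ends less.prems card_Suc_Diff1[of P "l e"] by simp
      ultimately show ?thesis using smaller by linarith
    next
      assume "\<forall>g\<in>F. r g = r e \<longrightarrow> g = e"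
      then have "card ?F < card P + card (Q - {r e})"
        by (intro less.hyps[OF smaller(1) lf]) (use less.prems ends in auto)
      moreover have "card Q = Suc (card (Q - {r e}))"
        using ends less.prems card_Suc_Diff1[of Q "r e"] by simp
      ultimately show ?thesis using smaller by linarith
    qed
  qed
qed

text \<open>The forest bound holds for each of two parts with no edge between them, and each part
  saves one.\<close>

lemma leafy_card_disconnected:
  assumes F: "leafy F l r" "finite F" and fin: "finite P" "finite Q"
    and ends: "l ` F \<subseteq> P" "r ` F \<subseteq> Q"
    and sub: "P1 \<subseteq> P" "Q1 \<subseteq> Q" and closed: "\<And>e. e \<in> F \<Longrightarrow> l e \<in> P1 \<longleftrightarrow> r e \<in> Q1"
    and ne: "P1 \<noteq> {} \<or> Q1 \<noteq> {}" "P - P1 \<noteq> {} \<or> Q - Q1 \<noteq> {}"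
  shows "card F + 2 \<le> card P + card Q"
proof -
  let ?F1 = "{e \<in> F. l e \<in> P1}" and ?F2 = "{e \<in> F. l e \<notin> P1}"
  have fin': "finite P1" "finite Q1" using sub fin by (auto intro: finite_subset)
  have "card ?F1 < card P1 + card Q1"
    by (rule leafy_card[OF leafy_mono[OF F(1)]]) (use F fin' ne closed in auto)
  moreover have "card ?F2 < card (P - P1) + card (Q - Q1)"
    by (rule leafy_card[OF leafy_mono[OF F(1)]]) (use F fin ne ends closed in auto)
  moreover have "card F = card ?F1 + card ?F2"
  proof -
    have "F = ?F1 \<union> ?F2" by blast
    then show ?thesis using F(2) card_Un_disjoint[of ?F1 ?F2] by auto
  qed
  moreover have "card P = card P1 + card (P - P1)" "card Q = card Q1 + card (Q - Q1)"
    using sub fin fin' by (simp_all add: card_Diff_subset card_mono)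
  ultimately show ?thesis by linarith
qed

text \<open>A trail in \<open>F\<close> starting with \<open>e\<close> from \<open>l e\<close>; the flag tells whether the last edge \<open>g\<close>
  is traversed from \<open>l g\<close> to \<open>r g\<close>.\<close>

inductive walk :: "'e set \<Rightarrow> ('e \<Rightarrow> 'a) \<Rightarrow> ('e \<Rightarrow> 'b) \<Rightarrow> 'e \<Rightarrow> bool \<Rightarrow> 'e \<Rightarrow> bool"
  for F l r e where
  start: "walk F l r e True e"
| step_l: "\<lbrakk>walk F l r e True g; h \<in> F; h \<noteq> g; r h = r g\<rbrakk> \<Longrightarrow> walk F l r e False h"
| step_r: "\<lbrakk>walk F l r e False g; h \<in> F; h \<noteq> g; l h = l g\<rbrakk> \<Longrightarrow> walk F l r e True h"

definition big_edges :: "'e set \<Rightarrow> ('e \<Rightarrow> 'a) \<Rightarrow> ('e \<Rightarrow> 'b) \<Rightarrow> 'e set" where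
  "big_edges E l r = {e \<in> E. 3 \<le> deg E l (l e) \<and> 3 \<le> deg E r (r e)}"

lemma big_edges_swap: "big_edges E r l = big_edges E l r"
  unfolding big_edges_def by auto

context minimal_elementary
begin

lemma tight_big_edge: "e \<in> big_edges E l r \<Longrightarrow> \<exists>X Y. tight A B E l r e X Y"
  using critical by (simp add: big_edges_def)

text \<open>Infinite descent: in a set without leaves, \<open>e\<close> is followed by some
  \<open>h\<close> at \<open>l e\<close> and some \<open>i\<close> at \<open>r h\<close>. Then
  \<open>X\<close> and \<open>X'\<close> cover \<open>A\<close> while \<open>X'\<close> and
  \<open>X''\<close> are disjoint, so \<open>X''\<close> lies in \<open>X\<close> and misses
  \<open>l e\<close>.\<close>

lemma leafy_big_edges: "leafy (big_edges E l r) l r"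
  unfolding leafy_def
proof (intro allI impI)
  fix S assume S: "S \<subseteq> big_edges E l r" "S \<noteq> {}"
  show "\<exists>e\<in>S. (\<forall>g\<in>S. l g = l e \<longrightarrow> g = e) \<or> (\<forall>g\<in>S. r g = r e \<longrightarrow> g = e)"
  proof (rule ccontr)
    assume no_leaf: "\<not> ?thesis"
    have "False" if "e \<in> S" "tight A B E l r e X Y" for e X Y
      using that
    proof (induction "card X" arbitrary: e X Y rule: less_induct)
      case less
      have big: "\<And>g. g \<in> S \<Longrightarrow> g \<in> E \<and> 3 \<le> deg E l (l g) \<and> 3 \<le> deg E r (r g)"
        using S by (auto simp: big_edges_def)
      obtain h where h: "h \<in> S" "l h = l e" "h \<noteq> e" using no_leaf less.prems(1) by blast
      obtain i where i: "i \<in> S" "r i = r h" "i \<noteq> h" using no_leaf h(1) by blast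
      obtain X' Y' where t': "tight A B E l r h X' Y'" using critical big h by blast
      obtain X'' Y'' where t'': "tight A B E l r i X'' Y''" using critical big i by blast
      have "X \<union> X' = A" using tight_at_l[OF less.prems(2) t'] h big less.prems(1) by auto
      moreover have "X' \<inter> X'' = {}" using tight_at_r[OF t' t''] h i big by auto
      moreover have "X'' \<subseteq> A" "X \<subseteq> A" using t'' less.prems(2) by (auto simp: tight_def)
      moreover have "l e \<in> X" "l e \<in> X'"
      proof -
        have "e \<in> leaving E l r X Y" "h \<in> leaving E l r X' Y'"
          using less.prems(2) t' by (auto simp: tight_def)
        then show "l e \<in> X" "l e \<in> X'" using h(2) by (auto simp: leaving_def)
      qed
      ultimately have "X'' \<subset> X" by blast
      moreover have "finite X" using \<open>X \<subseteq> A\<close> finite_A by (rule finite_subset)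
      ultimately have "card X'' < card X" by (rule psubset_card_mono[rotated])
      then show False using less.hyps i t'' by blast
    qed
    then show False using S critical unfolding big_edges_def by blast
  qed
qed

text \<open>The sides of the tight pairs that lie ahead of the trail are nested.\<close>

lemma walk_tight:
  assumes e: "e \<in> big_edges E l r" and t: "tight A B E l r e X Y"
    and w: "walk (big_edges E l r) l r e b g"
  shows "g \<in> big_edges E l r \<and> (\<exists>X' Y'. tight A B E l r g X' Y' \<and>
           (if b then X \<subseteq> X' \<and> Y \<subseteq> Y' else X \<inter> X' = {} \<and> Y \<inter> Y' = {}))"
  using w
proof induction
  case start
  then show ?case using e t by auto
next
  case (step_l g h)
  then obtain X' Y' where t': "tight A B E l r g X' Y'" "X \<subseteq> X'" "Y \<subseteq> Y'" by auto
  obtain X'' Y'' where t'': "tight A B E l r h X'' Y''"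
    using tight_big_edge step_l(2) by blast
  have "X' \<inter> X'' = {}" "Y' \<inter> Y'' = {}"
    using tight_at_r[OF t'(1) t''] step_l by (auto simp: big_edges_def)
  then have "X \<inter> X'' = {} \<and> Y \<inter> Y'' = {}" using t' by blast
  then show ?case using t'' step_l(2) by auto
next
  case (step_r g h)
  then obtain X' Y' where t': "tight A B E l r g X' Y'" "X \<inter> X' = {}" "Y \<inter> Y' = {}" by auto
  obtain X'' Y'' where t'': "tight A B E l r h X'' Y''"
    using tight_big_edge step_r(2) by blast
  have "X' \<union> X'' = A" "Y' \<union> Y'' = B"
    using tight_at_l[OF t'(1) t''] step_r by (auto simp: big_edges_def)
  moreover have "X \<subseteq> A" "Y \<subseteq> B" using t by (auto simp: tight_def)
  ultimately have "X \<subseteq> X'' \<and> Y \<subseteq> Y''" using t' by blast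
  then show ?case using t'' step_r(2) by auto
qed

text \<open>No forest edge joins a vertex reached by trails from \<open>e\<close> to one that is not
  reached. Both kinds occur among the vertices of large degree, so
  \<open>leafy_card_disconnected\<close> applies.\<close>

lemma card_big_edges_leaf:
  assumes e: "e \<in> big_edges E l r" and leaf: "\<And>g. g \<in> big_edges E l r \<Longrightarrow> l g = l e \<Longrightarrow> g = e"
    and irr: "\<And>a. a \<in> A \<Longrightarrow> deg E l a = 2 \<Longrightarrow> \<exists>!g. g \<in> E \<and> l g = a \<and> deg E r (r g) = 2"
  shows "card (big_edges E l r) + 2 \<le> card {a \<in> A. 3 \<le> deg E l a} + card {b \<in> B. 3 \<le> deg E r b}"
proof -
  let ?F = "big_edges E l r" and ?P = "{a \<in> A. 3 \<le> deg E l a}" and ?Q = "{b \<in> B. 3 \<le> deg E r b}"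
  let ?w = "walk ?F l r e"
  obtain X Y where t: "tight A B E l r e X Y" using tight_big_edge e by blast
  have XY: "X \<subseteq> A" "Y \<subseteq> B" "card X = card Y" using t by (auto simp: tight_def)
  have iff: "g \<in> E \<and> l g \<in> X \<and> r g \<notin> Y \<longleftrightarrow> g = e" for g
    using t by (auto simp: tight_def leaving_def)
  \<comment> \<open>\<open>RA\<close> and \<open>RB\<close> collect the left and right vertices at
    which trails arrive; the starting vertex \<open>l e\<close> is added by hand.\<close>
  define RA where "RA = insert (l e) {l g |g. ?w False g}"
  define RB where "RB = {r g |g. ?w True g}"
  have mem: "g \<in> E \<and> l g \<in> X' \<and> r g \<notin> Y'" if "tight A B E l r g X' Y'" for g X' Y'
    using that by (auto simp: tight_def leaving_def)
  \<comment> \<open>The last edge of a trail has its left end in some \<open>X'\<close> disjoint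
    from \<open>X\<close>, or its right end outside some \<open>Y'\<close> containing
    \<open>Y\<close>. So no trail arrives inside the tight pair of \<open>e\<close>.\<close>
  have RAX: "RA \<inter> X \<subseteq> {l e}"
    unfolding RA_def using walk_tight[OF e t] mem by fastforce
  have RBY: "RB \<inter> Y = {}"
    unfolding RB_def using walk_tight[OF e t] mem by fastforce
  have closed: "l g \<in> RA \<longleftrightarrow> r g \<in> RB" if g: "g \<in> ?F" for g
  proof
    assume "l g \<in> RA"
    then consider "l g = l e" | h where "?w False h" "l g = l h" by (auto simp: RA_def)
    then show "r g \<in> RB"
    proof cases
      case 1
      then show ?thesis using leaf[OF g] walk.start[of ?F l r e] by (auto simp: RB_def)
    next
      case 2
      show ?thesis
      proof (cases "g = h")
        case True
        from 2(1) show ?thesis unfolding RB_def True by cases auto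
      next
        case False
        then have "?w True g" using walk.step_r[OF 2(1) g] 2 by auto
        then show ?thesis by (auto simp: RB_def)
      qed
    qed
  next
    assume "r g \<in> RB"
    then obtain h where h: "?w True h" "r g = r h" by (auto simp: RB_def)
    show "l g \<in> RA"
    proof (cases "g = h")
      case True
      from h(1) show ?thesis unfolding RA_def True by cases auto
    next
      case False
      then have "?w False g" using walk.step_l[OF h(1) g] h by auto
      then show ?thesis by (auto simp: RA_def)
    qed
  qed
  have ends: "l ` ?F \<subseteq> ?P" "r ` ?F \<subseteq> ?Q" using l_in r_in by (auto simp: big_edges_def)
  have "\<not> (?P \<subseteq> RA \<and> ?Q \<subseteq> RB)"
  proof
    assume all: "?P \<subseteq> RA \<and> ?Q \<subseteq> RB"
    have "X \<subseteq> {l e}"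
    proof
      fix x assume x: "x \<in> X"
      show "x \<in> {l e}"
      proof (rule ccontr)
        assume ne: "x \<notin> {l e}"
        then have "\<not> 3 \<le> deg E l x" using all RAX x XY by auto
        then have d: "deg E l x = 2" using deg_l_ge_2[of x] x XY by auto
        \<comment> \<open>By \<open>irr\<close> only one neighbour of \<open>x\<close> has degree
          two. The other is large, hence in \<open>RB\<close>, yet it lies in \<open>Y\<close>
          because \<open>e\<close> is the only leaving edge.\<close>
        then obtain g1 where g1: "\<And>g. g \<in> E \<Longrightarrow> l g = x \<Longrightarrow> deg E r (r g) = 2 \<Longrightarrow> g = g1"
          using irr[of x] x XY by blast
        have "\<not> {g \<in> E. l g = x} \<subseteq> {g1}"
        proof
          assume "{g \<in> E. l g = x} \<subseteq> {g1}"
          then have "card {g \<in> E. l g = x} \<le> card {g1}" by (intro card_mono) auto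
          then show False using d by (simp add: deg_def)
        qed
        then obtain h where h: "h \<in> E" "l h = x" "h \<noteq> g1" by blast
        then have "3 \<le> deg E r (r h)" using g1[of h] deg_r_ge_2[of "r h"] r_in[of h] by force
        then have "r h \<in> RB" using all r_in h by auto
        moreover have "r h \<in> Y" using iff[of h] h x ne by auto
        ultimately show False using RBY by blast
      qed
    qed
    moreover have "l e \<in> X" using mem[OF t] by simp
    ultimately have X: "X = {l e}" by blast
    then have "card Y = 1" using XY by simp
    then obtain y where Y: "Y = {y}" by (auto simp: card_1_singleton_iff)
    \<comment> \<open>Apart from \<open>e\<close>, all edges at \<open>l e\<close> go to the single
      vertex of \<open>Y\<close>, so there is at most one.\<close>
    have "card {g \<in> E. l g = l e} \<le> card (insert e {g \<in> E. l g = l e \<and> r g = y})"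
      using iff X Y finite_E by (intro card_mono) auto
    also have "\<dots> \<le> Suc (card {g \<in> E. l g = l e \<and> r g = y})"
      by (rule card_insert_le_m1) auto
    also have "card {g \<in> E. l g = l e \<and> r g = y} \<le> 1"
      unfolding One_nat_def by (rule card_le_Suc0_iff_eq[THEN iffD2]) (use finite_E no_parallel in auto)
    finally show False using e by (simp add: big_edges_def deg_def)
  qed
  then have ne: "?P - RA \<inter> ?P \<noteq> {} \<or> ?Q - RB \<inter> ?Q \<noteq> {}" by blast
  have "l e \<in> RA \<inter> ?P" using ends e by (auto simp: RA_def)
  then have ne': "RA \<inter> ?P \<noteq> {} \<or> RB \<inter> ?Q \<noteq> {}" by blast
  have fin: "finite ?F" "finite ?P" "finite ?Q"
    using finite_A finite_B finite_E by (auto simp: big_edges_def)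
  have "l g \<in> RA \<inter> ?P \<longleftrightarrow> r g \<in> RB \<inter> ?Q" if "g \<in> ?F" for g
    using closed[OF that] ends that by blast
  from leafy_card_disconnected[OF leafy_big_edges fin ends _ _ this ne' ne]
  show ?thesis by blast
qed

end

section \<open>Counting edges in irreducible graphs\<close>

context elementary
begin

lemma card_edges_deg_2: "card {e \<in> E. deg E l (l e) = 2} = 2 * card {a \<in> A. deg E l a = 2}"
proof -
  let ?P = "{a \<in> A. deg E l a = 2}"
  have "{e \<in> E. deg E l (l e) = 2} = (\<Union>a\<in>?P. {e \<in> E. l e = a})" using l_in by auto
  also have "card \<dots> = (\<Sum>a\<in>?P. card {e \<in> E. l e = a})"
    using finite_A finite_E by (intro card_UN_disjoint) auto
  also have "\<dots> = (\<Sum>a\<in>?P. 2)" by (intro sum.cong) (auto simp: deg_def)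
  finally show ?thesis by simp
qed

lemma card_deg_2_plus: "card {a \<in> A. deg E l a = 2} + card {a \<in> A. 3 \<le> deg E l a} = card A"
proof -
  have "A = {a \<in> A. deg E l a = 2} \<union> {a \<in> A. 3 \<le> deg E l a}"
    using deg_l_ge_2 by force
  moreover have "card ({a \<in> A. deg E l a = 2} \<union> {a \<in> A. 3 \<le> deg E l a})
      = card {a \<in> A. deg E l a = 2} + card {a \<in> A. 3 \<le> deg E l a}"
    using finite_A by (intro card_Un_disjoint) auto
  ultimately show ?thesis by simp
qed

lemma num_edges2_eq:
  assumes "\<And>a. a \<in> A \<Longrightarrow> deg E l a = 2 \<Longrightarrow> \<exists>!g. g \<in> E \<and> l g = a \<and> deg E r (r g) = 2"
  shows "num_edges2 E l r = card {a \<in> A. deg E l a = 2}"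
proof -
  let ?M = "{e \<in> E. deg E l (l e) = 2 \<and> deg E r (r e) = 2}"
  have "bij_betw l ?M {a \<in> A. deg E l a = 2}"
    unfolding bij_betw_def
  proof
    show "inj_on l ?M"
    proof (rule inj_onI)
      fix x y assume "x \<in> ?M" "y \<in> ?M" "l x = l y"
      then show "x = y" using assms[of "l x"] l_in[of x] by auto
    qed
    show "l ` ?M = {a \<in> A. deg E l a = 2}"
    proof (intro equalityI subsetI)
      fix a assume a: "a \<in> {a \<in> A. deg E l a = 2}"
      then obtain g where "g \<in> E" "l g = a" "deg E r (r g) = 2" using assms[of a] by blast
      then show "a \<in> l ` ?M" using a by auto
    qed (use l_in in auto)
  qed
  then show ?thesis unfolding num_edges2_def by (rule bij_betw_same_card)
qed

end

context minimal_elementary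
begin

text \<open>A nonempty forest has a leaf; for a leaf in \<open>B\<close> the classes are exchanged.
  Without forest edges, \<open>ne\<close> supplies the two vertices that the bound asks for.\<close>

lemma card_big_edges_le:
  assumes irr: "\<And>a. a \<in> A \<Longrightarrow> deg E l a = 2 \<Longrightarrow> \<exists>!g. g \<in> E \<and> l g = a \<and> deg E r (r g) = 2"
    and irr': "\<And>b. b \<in> B \<Longrightarrow> deg E r b = 2 \<Longrightarrow> \<exists>!g. g \<in> E \<and> r g = b \<and> deg E l (l g) = 2"
    and ne: "{a \<in> A. 3 \<le> deg E l a} \<noteq> {}" "{b \<in> B. 3 \<le> deg E r b} \<noteq> {}"
  shows "card (big_edges E l r) + 2 \<le> card {a \<in> A. 3 \<le> deg E l a} + card {b \<in> B. 3 \<le> deg E r b}"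
proof (cases "big_edges E l r = {}")
  case True
  moreover have "0 < card {a \<in> A. 3 \<le> deg E l a}" "0 < card {b \<in> B. 3 \<le> deg E r b}"
    using ne finite_A finite_B by (simp_all add: card_gt_0_iff)
  ultimately show ?thesis by simp
next
  case False
  then obtain e where e: "e \<in> big_edges E l r" and
    "(\<forall>g\<in>big_edges E l r. l g = l e \<longrightarrow> g = e) \<or> (\<forall>g\<in>big_edges E l r. r g = r e \<longrightarrow> g = e)"
    using leafy_big_edges unfolding leafy_def by blast
  from this(2) show ?thesis
  proof
    assume "\<forall>g\<in>big_edges E l r. l g = l e \<longrightarrow> g = e"
    then show ?thesis using card_big_edges_leaf[OF e] irr by blast
  next
    assume leaf: "\<forall>g\<in>big_edges E l r. r g = r e \<longrightarrow> g = e"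
    interpret s: minimal_elementary B A E r l
      by (rule minimal_elementary_swap) unfold_locales
    have "card (big_edges E r l) + 2 \<le> card {b \<in> B. 3 \<le> deg E r b} + card {a \<in> A. 3 \<le> deg E l a}"
      by (rule s.card_big_edges_leaf[of e]) (use e leaf irr' in \<open>simp_all only: big_edges_swap[of E r l]\<close>)
    then show ?thesis by (simp add: big_edges_swap[of E r l] add.commute)
  qed
qed

text \<open>Let \<open>q\<close> be the number of edges joining vertices of degree two. Each class
  has \<open>q\<close> vertices of degree two, so \<open>3 * q\<close> edges meet such a vertex, by
  inclusion and exclusion. The remaining edges form the forest on the
  \<open>2 * (card A - q)\<close> large vertices and number at least two fewer.\<close>

lemma irreducible_bound:
  assumes irr: "\<And>a. a \<in> A \<Longrightarrow> deg E l a = 2 \<Longrightarrow> \<exists>!g. g \<in> E \<and> l g = a \<and> deg E r (r g) = 2"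
    and irr': "\<And>b. b \<in> B \<Longrightarrow> deg E r b = 2 \<Longrightarrow> \<exists>!g. g \<in> E \<and> r g = b \<and> deg E l (l g) = 2"
    and m: "2 * card A < card E"
  shows "num_deg2 A B E l r = 2 * num_edges2 E l r"
    and "card E + 2 \<le> num_edges2 E l r + 2 * card A"
proof -
  interpret s: minimal_elementary B A E r l
    by (rule minimal_elementary_swap) unfold_locales
  let ?q = "num_edges2 E l r"
  let ?L = "{e \<in> E. deg E l (l e) = 2}" and ?R = "{e \<in> E. deg E r (r e) = 2}"
  have qA: "card {a \<in> A. deg E l a = 2} = ?q" using num_edges2_eq irr by simp
  have "num_edges2 E r l = ?q" unfolding num_edges2_def by (simp add: conj_commute)
  then have qB: "card {b \<in> B. deg E r b = 2} = ?q" using s.num_edges2_eq irr' by simp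
  show "num_deg2 A B E l r = 2 * ?q" using qA qB by (simp add: num_deg2_def)
  have "E = (?L \<union> ?R) \<union> big_edges E l r"
    using deg_l_ge_2 deg_r_ge_2 l_in r_in unfolding big_edges_def by fastforce
  moreover have "card ((?L \<union> ?R) \<union> big_edges E l r) = card (?L \<union> ?R) + card (big_edges E l r)"
    using finite_E by (intro card_Un_disjoint) (auto simp: big_edges_def)
  ultimately have "card E = card (?L \<union> ?R) + card (big_edges E l r)" by simp
  moreover have "?L \<inter> ?R = {e \<in> E. deg E l (l e) = 2 \<and> deg E r (r e) = 2}" by auto
  then have "card (?L \<union> ?R) + ?q = card ?L + card ?R"
    using card_Un_Int[of ?L ?R] finite_E by (simp add: num_edges2_def)
  ultimately have cE: "card E = 3 * ?q + card (big_edges E l r)"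
    using card_edges_deg_2 s.card_edges_deg_2 qA qB by simp
  have big: "?q + card {a \<in> A. 3 \<le> deg E l a} = card A" "?q + card {b \<in> B. 3 \<le> deg E r b} = card A"
    using card_deg_2_plus s.card_deg_2_plus qA qB card_eq by simp_all
  \<comment> \<open>Here \<open>m\<close> excludes the cycle. By \<open>big\<close> both classes
    have equally many large vertices, so \<open>B\<close> has one as well.\<close>
  have neA: "{a \<in> A. 3 \<le> deg E l a} \<noteq> {}"
  proof
    assume em: "{a \<in> A. 3 \<le> deg E l a} = {}"
    then have "deg E l a = 2" if "a \<in> A" for a using deg_l_ge_2[OF that] that by force
    then have "card E = 2 * card A" using card_E_l by simp
    then show False using m by simp
  qed
  then have "0 < card {a \<in> A. 3 \<le> deg E l a}" using finite_A by (simp add: card_gt_0_iff)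
  then have "0 < card {b \<in> B. 3 \<le> deg E r b}" using big by linarith
  then have neB: "{b \<in> B. 3 \<le> deg E r b} \<noteq> {}" by (metis card.empty less_numeral_extra(3))
  have "card (big_edges E l r) + 2
      \<le> card {a \<in> A. 3 \<le> deg E l a} + card {b \<in> B. 3 \<le> deg E r b}"
    by (rule card_big_edges_le[OF irr irr' neA neB])
  then show "card E + 2 \<le> ?q + 2 * card A" using cE big by linarith
qed

lemma card_ge_3: "2 * card A < card E \<Longrightarrow> 3 \<le> card A"
proof (rule ccontr)
  assume m: "2 * card A < card E" and "\<not> 3 \<le> card A"
  then have "card A = 2" using card_ge by simp
  moreover have "card E \<le> card (A \<times> B)"
    by (rule card_inj_on_le[where f = "\<lambda>e. (l e, r e)"])
      (use no_parallel l_in r_in finite_A finite_B in \<open>auto intro: inj_onI\<close>)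
  ultimately show False using m card_eq by (simp add: card_cartesian_product)
qed

text \<open>If not exactly one edge at \<open>a\<close> ends in a vertex of degree two, then both or
  none do: the two cases of \<open>bicontract\<close>. One vertex fewer in each class and two edges
  fewer leave \<open>m - n + 2\<close> unchanged.\<close>

lemma reduce:
  assumes a: "a \<in> A" "deg E l a = 2" and m: "2 * card A < card E"
    and red: "\<not> (\<exists>!g. g \<in> E \<and> l g = a \<and> deg E r (r g) = 2)"
  shows "\<exists>A' (B' :: 'b set) E' r'. minimal_elementary A' B' E' l r' \<and> card A = card A' + 1 \<and>
           card E = card E' + 2 \<and> num_deg2 A' B' E' l r' < num_deg2 A B E l r"
proof -
  obtain e1 e2 where e12: "{e \<in> E. l e = a} = {e1, e2}" "e1 \<noteq> e2"
    using a(2) by (auto simp: deg_def card_2_iff)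
  have eE: "e1 \<in> E" "e2 \<in> E" using e12 by auto
  have at: "g \<in> E \<and> l g = a \<longleftrightarrow> g = e1 \<or> g = e2" for g using e12(1) by blast
  have "deg E r (r e1) = 2 \<longleftrightarrow> deg E r (r e2) = 2" using red at e12(2) by metis
  then have degs: "(3 \<le> deg E r (r e1) \<and> 3 \<le> deg E r (r e2)) \<or> (deg E r (r e1) = 2 \<and> deg E r (r e2) = 2)"
    using deg_r_ge_2[OF r_in[OF eE(1)]] deg_r_ge_2[OF r_in[OF eE(2)]] by linarith
  note bicontract[OF a(1) e12 degs card_ge_3[OF m]]
  moreover have "card A = card (A - {a}) + 1"
    using card_Suc_Diff1[OF finite_A a(1)] by simp
  moreover have "card E = card (E - {e1, e2}) + 2"
    using eE e12(2) finite_E card_mono[of E "{e1, e2}"] by (simp add: card_Diff_subset)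
  ultimately show ?thesis by blast
qed

end

text \<open>With \<open>k = card E - 2 * card A + 2\<close> this bounds the number of vertices of
  degree two below by \<open>2 * k\<close>; the additive form avoids truncated subtraction. A
  reduction keeps \<open>k\<close> but strictly lowers \<open>num_deg2\<close>, so reducible graphs
  never attain equality; the others fall under \<open>irreducible_bound\<close>.\<close>

theorem num_deg2_bound:
  assumes "minimal_elementary A B E l r" "2 * card A < card E"
  shows "2 * (card E + 2) \<le> num_deg2 A B E l r + 4 * card A \<and>
    (num_deg2 A B E l r + 4 * card A = 2 * (card E + 2) \<longrightarrow> num_edges2 E l r + 2 * card A = card E + 2)"
  using assms
proof (induction "card A" arbitrary: A B E l r rule: less_induct)
  case less
  interpret minimal_elementary A B E l r by fact
  interpret s: minimal_elementary B A E r l by (rule minimal_elementary_swap) fact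
  define P where "P a \<longleftrightarrow> (\<exists>!g. g \<in> E \<and> l g = a \<and> deg E r (r g) = 2)" for a
  define Q where "Q b \<longleftrightarrow> (\<exists>!g. g \<in> E \<and> r g = b \<and> deg E l (l g) = 2)" for b
  consider a where "a \<in> A" "deg E l a = 2" "\<not> P a"
    | b where "b \<in> B" "deg E r b = 2" "\<not> Q b"
    | "\<And>a. a \<in> A \<Longrightarrow> deg E l a = 2 \<Longrightarrow> P a" "\<And>b. b \<in> B \<Longrightarrow> deg E r b = 2 \<Longrightarrow> Q b"
    by blast
  then show ?case
  proof cases
    case 1
    from reduce[OF 1(1,2) less.prems(2) 1(3)[unfolded P_def]] obtain A' E' r' and B' :: "'b set" where
      r: "minimal_elementary A' B' E' l r'" "card A = card A' + 1" "card E = card E' + 2"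
      "num_deg2 A' B' E' l r' < num_deg2 A B E l r" by blast
    have "2 * (card E' + 2) \<le> num_deg2 A' B' E' l r' + 4 * card A'"
      using less.hyps[OF _ r(1)] r(2,3) less.prems(2) by simp
    then show ?thesis using r by simp
  next
    case 2
    have "2 * card B < card E" using less.prems(2) card_eq by simp
    from s.reduce[OF 2(1,2) this 2(3)[unfolded Q_def]] obtain B' E' l' and A' :: "'a set" where
      r: "minimal_elementary B' A' E' r l'" "card B = card B' + 1" "card E = card E' + 2"
      "num_deg2 B' A' E' r l' < num_deg2 B A E r l" by blast
    have m: "minimal_elementary A' B' E' l' r" by (rule minimal_elementary_swap) fact
    then interpret c: minimal_elementary A' B' E' l' r .
    have "2 * (card E' + 2) \<le> num_deg2 A' B' E' l' r + 4 * card A'"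
      using less.hyps[OF _ m] r(2,3) less.prems(2) card_eq c.card_eq by simp
    moreover have "num_deg2 A' B' E' l' r < num_deg2 A B E l r" using r(4) by (simp add: num_deg2_def)
    ultimately have "2 * (card E + 2) < num_deg2 A B E l r + 4 * card A"
      using r(2,3) card_eq c.card_eq using [[show_types]] by simp
    then show ?thesis by simp
  next
    case 3
    have "num_deg2 A B E l r = 2 * num_edges2 E l r"
      "card E + 2 \<le> num_edges2 E l r + 2 * card A"
      by (rule irreducible_bound; fact 3[unfolded P_def Q_def] less.prems(2))+
    then show ?thesis by simp
  qed
qed

section \<open>Perfect matchings\<close>

text \<open>Hall's theorem by the usual induction: if some proper nonempty \<open>X\<close> has
  exactly \<open>card X\<close> neighbours, \<open>X\<close> and \<open>A - X\<close> are matched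
  separately. Otherwise every such set has a neighbour to spare, and any edge may be fixed
  first.\<close>

lemma hall:
  assumes "finite A" "finite E" "\<And>X. X \<subseteq> A \<Longrightarrow> card X \<le> card (r ` {e \<in> E. l e \<in> X})"
  shows "\<exists>M\<subseteq>E. bij_betw l M A \<and> inj_on r M"
  using assms
proof (induction "card A" arbitrary: A E rule: less_induct)
  case less
  let ?N = "\<lambda>X. r ` {e \<in> E. l e \<in> X}"
  have finN: "finite (r ` {e \<in> E'. P e})" if "E' \<subseteq> E" for E' P
    using less.prems(2) that by (auto intro: finite_subset)
  show ?case
  proof (cases "A = {}")
    case True
    then show ?thesis by (intro exI[of _ "{}"]) (auto simp: bij_betw_def)
  next
    case A: False
    show ?thesis
    proof (cases "\<exists>X. X \<subseteq> A \<and> X \<noteq> {} \<and> X \<noteq> A \<and> card (?N X) = card X")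
      case True
      then obtain X where X: "X \<subseteq> A" "X \<noteq> {}" "X \<noteq> A" "card (?N X) = card X" by blast
      have finX: "finite X" using X(1) less.prems(1) by (rule finite_subset)
      let ?E1 = "{e \<in> E. l e \<in> X}" and ?E2 = "{e \<in> E. l e \<notin> X \<and> r e \<notin> ?N X}"
      have "\<exists>M\<subseteq>?E1. bij_betw l M X \<and> inj_on r M"
      proof (rule less.hyps)
        show "card X < card A" using X less.prems(1) by (simp add: psubset_card_mono psubset_eq)
        fix Z assume Z: "Z \<subseteq> X"
        then have "{e \<in> ?E1. l e \<in> Z} = {e \<in> E. l e \<in> Z}" by auto
        then show "card Z \<le> card (r ` {e \<in> ?E1. l e \<in> Z})" using less.prems(3)[of Z] Z X(1) by simp
      qed (use finX less.prems in auto)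
      then obtain M1 where M1: "M1 \<subseteq> ?E1" "bij_betw l M1 X" "inj_on r M1" by blast
      have "\<exists>M\<subseteq>?E2. bij_betw l M (A - X) \<and> inj_on r M"
      proof (rule less.hyps)
        have "A - X \<subset> A" using X by blast
        then show "card (A - X) < card A" using less.prems(1) by (rule psubset_card_mono[rotated])
        fix Z assume Z: "Z \<subseteq> A - X"
        \<comment> \<open>As \<open>X\<close> has only \<open>card X\<close> neighbours, the
          condition for \<open>X \<union> Z\<close> leaves at least \<open>card Z\<close> neighbours
          of \<open>Z\<close> outside them.\<close>
        have "card X + card Z = card (X \<union> Z)"
          using Z finX less.prems(1) by (subst card_Un_disjoint) (auto intro: finite_subset)
        also have "\<dots> \<le> card (?N (X \<union> Z))" using Z X(1) by (intro less.prems(3)) auto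
        also have "\<dots> \<le> card (?N X \<union> r ` {e \<in> ?E2. l e \<in> Z})"
          using Z finN[of E] finN[of ?E2] by (intro card_mono) auto
        also have "\<dots> \<le> card (?N X) + card (r ` {e \<in> ?E2. l e \<in> Z})" by (rule card_Un_le)
        finally show "card Z \<le> card (r ` {e \<in> ?E2. l e \<in> Z})" using X(4) by simp
      qed (use less.prems in auto)
      then obtain M2 where M2: "M2 \<subseteq> ?E2" "bij_betw l M2 (A - X)" "inj_on r M2" by blast
      have "bij_betw l (M1 \<union> M2) (X \<union> (A - X))"
        using M1 M2 by (intro bij_betw_combine) auto
      moreover have "X \<union> (A - X) = A" using X(1) by blast
      moreover have "inj_on r (M1 \<union> M2)"
      proof -
        have "r x \<noteq> r y" if "x \<in> M1" "y \<in> M2" for x y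
        proof -
          have "r x \<in> ?N X" "r y \<notin> ?N X" using M1(1) M2(1) that by auto
          then show ?thesis by metis
        qed
        then show ?thesis using M1(3) M2(3) unfolding inj_on_def by (metis UnE)
      qed
      ultimately show ?thesis using M1(1) M2(1) by (intro exI[of _ "M1 \<union> M2"]) auto
    next
      case no_tight: False
      obtain a where a: "a \<in> A" using A by blast
      have "card {a} \<le> card (?N {a})" using a by (intro less.prems(3)) auto
      then have "?N {a} \<noteq> {}" by (auto simp del: image_is_empty)
      then obtain e where e: "e \<in> E" "l e = a" by auto
      let ?E' = "{g \<in> E. r g \<noteq> r e}"
      have "\<exists>M\<subseteq>?E'. bij_betw l M (A - {a}) \<and> inj_on r M"
      proof (rule less.hyps)
        show "card (A - {a}) < card A" using less.prems(1) a by (rule card_Diff1_less)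
        fix Z assume Z: "Z \<subseteq> A - {a}"
        show "card Z \<le> card (r ` {g \<in> ?E'. l g \<in> Z})"
        proof (cases "Z = {}")
          case False
          have ZA: "Z \<subseteq> A" "Z \<noteq> A" using Z a by auto
          then have "card (?N Z) \<noteq> card Z" using no_tight False by blast
          then have "card Z < card (?N Z)" using less.prems(3)[OF ZA(1)] by linarith
          also have "card (?N Z) \<le> card (insert (r e) (r ` {g \<in> ?E'. l g \<in> Z}))"
            using finN[of ?E'] by (intro card_mono) auto
          also have "\<dots> \<le> Suc (card (r ` {g \<in> ?E'. l g \<in> Z}))" by (rule card_insert_le_m1) auto
          finally show ?thesis by simp
        qed simp
      qed (use less.prems in auto)
      then obtain M where M: "M \<subseteq> ?E'" "bij_betw l M (A - {a})" "inj_on r M" by blast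
      have "bij_betw l (insert e M) (insert a (A - {a}))"
        using M e by (auto simp: bij_betw_def)
      moreover have "insert a (A - {a}) = A" using a by blast
      moreover have "inj_on r (insert e M)" using M by auto
      ultimately show ?thesis using M(1) e(1) by (intro exI[of _ "insert e M"]) auto
    qed
  qed
qed

text \<open>After removing both ends of \<open>e\<close>, Hall's condition persists: the surplus of
  one makes up for the loss of \<open>r e\<close>.\<close>

lemma (in elementary) perfect_matching_ex:
  assumes e: "e \<in> E"
  shows "\<exists>M\<subseteq>E. e \<in> M \<and> bij_betw l M A \<and> bij_betw r M B"
proof -
  let ?E' = "{g \<in> E. r g \<noteq> r e}"
  have "\<exists>M\<subseteq>?E'. bij_betw l M (A - {l e}) \<and> inj_on r M"
  proof (rule hall)
    fix Z assume Z: "Z \<subseteq> A - {l e}"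
    let ?Y = "r ` {g \<in> E. l g \<in> Z}"
    show "card Z \<le> card (r ` {g \<in> ?E'. l g \<in> Z})"
    proof (cases "Z = {}")
      case False
      have "card Z < card ?Y"
      proof (cases "?Y = B")
        case True
        have "Z \<subset> A" using Z l_in[OF e] by blast
        then show ?thesis using True card_eq psubset_card_mono[OF finite_A] by simp
      next
        case False
        show ?thesis
          by (rule surplus) (use Z \<open>Z \<noteq> {}\<close> False r_in in \<open>auto simp: leaving_def\<close>)
      qed
      also have "card ?Y \<le> card (insert (r e) (r ` {g \<in> ?E'. l g \<in> Z}))"
        using finite_E by (intro card_mono) auto
      also have "\<dots> \<le> Suc (card (r ` {g \<in> ?E'. l g \<in> Z}))" by (rule card_insert_le_m1) auto
      finally show ?thesis by simp
    qed simp
  qed (use finite_A finite_E in auto)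
  then obtain M where M: "M \<subseteq> ?E'" "bij_betw l M (A - {l e})" "inj_on r M" by blast
  let ?M = "insert e M"
  have "bij_betw l ?M (insert (l e) (A - {l e}))" using M by (auto simp: bij_betw_def)
  then have l: "bij_betw l ?M A" using l_in[OF e] by (simp add: insert_absorb)
  have "inj_on r ?M" using M by auto
  moreover have "r ` ?M = B"
  proof (rule card_seteq[OF finite_B])
    show "r ` ?M \<subseteq> B" using M(1) r_in e by auto
    show "card B \<le> card (r ` ?M)"
      using card_image[OF \<open>inj_on r ?M\<close>] bij_betw_same_card[OF l] card_eq by simp
  qed
  ultimately have "bij_betw r ?M B" by (simp add: bij_betw_def)
  with l show ?thesis using M(1) e by (intro exI[of _ ?M]) auto
qed

section \<open>Multigraphs with a fixed bipartition\<close>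

locale bipartite_graph =
  fixes G :: "('v, 'e) mgraph" and A B :: "'v set" and l r :: "'e \<Rightarrow> 'v"
  assumes multigraph: "multigraph G" and verts: "verts G = A \<union> B" and disjoint: "A \<inter> B = {}"
    and l_in: "e \<in> edges G \<Longrightarrow> l e \<in> A" and r_in: "e \<in> edges G \<Longrightarrow> r e \<in> B"
    and ends: "e \<in> edges G \<Longrightarrow> ends G e = {l e, r e}"
begin

lemma finite: "finite A" "finite B" "finite (edges G)"
  using multigraph verts by (auto simp: multigraph_def)

lemma in_ends_l: "e \<in> edges G \<Longrightarrow> v \<in> A \<Longrightarrow> v \<in> ends G e \<longleftrightarrow> l e = v"
  using ends r_in disjoint by auto

lemma in_ends_r: "e \<in> edges G \<Longrightarrow> v \<in> B \<Longrightarrow> v \<in> ends G e \<longleftrightarrow> r e = v"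
  using ends l_in disjoint by auto

lemma degree_l: "v \<in> A \<Longrightarrow> degree G v = deg (edges G) l v"
  unfolding degree_def deg_def using in_ends_l[of _ v] by (intro arg_cong[of _ _ card]) auto

lemma degree_r: "v \<in> B \<Longrightarrow> degree G v = deg (edges G) r v"
  unfolding degree_def deg_def using in_ends_r[of _ v] by (intro arg_cong[of _ _ card]) auto

lemma card_V2: "card (V2 G) = num_deg2 A B (edges G) l r"
proof -
  have "V2 G = {a \<in> A. deg (edges G) l a = 2} \<union> {b \<in> B. deg (edges G) r b = 2}"
    unfolding V2_def verts using degree_l degree_r by auto
  moreover have "{a \<in> A. deg (edges G) l a = 2} \<inter> {b \<in> B. deg (edges G) r b = 2} = {}"
    using disjoint by auto
  ultimately show ?thesis using finite by (simp add: num_deg2_def card_Un_disjoint)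
qed

lemma card_E2: "card (E2 G) = num_edges2 (edges G) l r"
proof -
  have "E2 G = {e \<in> edges G. deg (edges G) l (l e) = 2 \<and> deg (edges G) r (r e) = 2}"
    unfolding E2_def using ends degree_l degree_r l_in r_in by auto
  then show ?thesis by (simp add: num_edges2_def)
qed

lemma card_verts: "card (verts G) = card A + card B"
  using finite disjoint by (simp add: verts card_Un_disjoint)

lemma perfect_matching_iff:
  "perfect_matching G M \<longleftrightarrow> M \<subseteq> edges G \<and> bij_betw l M A \<and> bij_betw r M B"
proof (cases "M \<subseteq> edges G")
  case True
  have bij: "bij_betw f M C \<longleftrightarrow> (\<forall>v\<in>C. \<exists>!e. e \<in> M \<and> f e = v)" if "f ` M \<subseteq> C" for f :: "'e \<Rightarrow> 'v" and C
    using that unfolding bij_betw_def inj_on_def by blast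
  have lM: "l ` M \<subseteq> A" and rM: "r ` M \<subseteq> B" using True l_in r_in by auto
  have "(\<forall>v\<in>verts G. \<exists>!e. e \<in> M \<and> v \<in> ends G e) \<longleftrightarrow>
      (\<forall>v\<in>A. \<exists>!e. e \<in> M \<and> v \<in> ends G e) \<and> (\<forall>v\<in>B. \<exists>!e. e \<in> M \<and> v \<in> ends G e)"
    unfolding verts by blast
  also have "(\<forall>v\<in>A. \<exists>!e. e \<in> M \<and> v \<in> ends G e) \<longleftrightarrow> (\<forall>v\<in>A. \<exists>!e. e \<in> M \<and> l e = v)"
    using True in_ends_l by (intro ball_cong arg_cong[of _ _ Ex1] ext conj_cong refl) (auto dest: subsetD)
  also have "(\<forall>v\<in>B. \<exists>!e. e \<in> M \<and> v \<in> ends G e) \<longleftrightarrow> (\<forall>v\<in>B. \<exists>!e. e \<in> M \<and> r e = v)"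
    using True in_ends_r by (intro ball_cong arg_cong[of _ _ Ex1] ext conj_cong refl) (auto dest: subsetD)
  finally show ?thesis
    using True bij[OF lM] bij[OF rM] by (simp add: perfect_matching_def)
qed (simp add: perfect_matching_def)

text \<open>If no edge leaves \<open>(X, Y)\<close> and \<open>X\<close> is not smaller than
  \<open>Y\<close>, every perfect matching maps \<open>X\<close> onto \<open>Y\<close>. As every
  edge lies in one, no edge enters \<open>Y\<close> from outside \<open>X\<close>, so
  \<open>X \<union> Y\<close> is cut off, against connectedness.\<close>

lemma matching_covered_imp_elementary:
  assumes mc: "matching_covered G"
  shows "elementary A B (edges G) l r"
proof -
  have conn: "\<And>u v. u \<in> verts G \<Longrightarrow> v \<in> verts G \<Longrightarrow> (u, v) \<in> (adjacent G)\<^sup>*"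
    and card4: "4 \<le> card (verts G)"
    and cov: "\<And>e. e \<in> edges G \<Longrightarrow> \<exists>M. perfect_matching G M \<and> e \<in> M"
    using mc by (auto simp: matching_covered_def connected_graph_def)
  have "\<exists>u\<in>verts G. \<exists>v\<in>verts G. u \<noteq> v"
  proof (rule ccontr)
    assume "\<not> ?thesis"
    then have "card (verts G) \<le> Suc 0" using finite by (subst card_le_Suc0_iff_eq) (auto simp: verts)
    then show False using card4 by simp
  qed
  then obtain u v where uv: "u \<in> verts G" "v \<in> verts G" "u \<noteq> v" by blast
  \<comment> \<open>An edge yields a perfect matching, and with it
    \<open>card A = card B\<close>.\<close>
  have "edges G \<noteq> {}"
  proof
    assume "edges G = {}"
    then have "adjacent G = {}" by (auto simp: adjacent_def)
    then show False using conn[OF uv(1,2)] uv(3) by simp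
  qed
  then obtain M where "perfect_matching G M" using cov by blast
  then have cardAB: "card A = card B"
    unfolding perfect_matching_iff using bij_betw_same_card by metis
  show ?thesis
  proof unfold_locales
    fix X Y
    assume XY: "X \<subseteq> A" "Y \<subseteq> B" "X \<noteq> {}" "Y \<noteq> B" and clo: "leaving (edges G) l r X Y = {}"
    have finY: "finite Y" using XY(2) finite(2) by (rule finite_subset)
    have fwd: "r e \<in> Y" if "e \<in> edges G" "l e \<in> X" for e
      using clo that by (auto simp: leaving_def)
    show "card X < card Y"
    proof (rule ccontr)
      assume le: "\<not> card X < card Y"
      have bwd: "l e \<in> X" if e: "e \<in> edges G" "r e \<in> Y" for e
      proof -
        obtain M where "perfect_matching G M" and eM: "e \<in> M" using cov e by blast
        then have M: "M \<subseteq> edges G" "bij_betw l M A" "bij_betw r M B"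
          by (auto simp: perfect_matching_iff)
        let ?MX = "{g \<in> M. l g \<in> X}"
        have "l ` ?MX = X" using M(2) XY(1) by (force simp: bij_betw_def)
        then have "card X \<le> card ?MX"
          using M(1) finite(3) by (metis (no_types, lifting) card_image_le finite_subset mem_Collect_eq subsetI)
        also have "card ?MX = card (r ` ?MX)"
          using M(3) by (intro card_image[symmetric]) (auto simp: bij_betw_def inj_on_def)
        finally have "card Y \<le> card (r ` ?MX)" using le by simp
        moreover have "r ` ?MX \<subseteq> Y" using fwd M(1) by auto
        ultimately have "r ` ?MX = Y" using finY by (intro card_seteq)
        then obtain g where "g \<in> ?MX" "r g = r e" using e(2) by force
        then have "g = e" using M(3) eM by (auto simp: bij_betw_def inj_on_def)
        then show ?thesis using \<open>g \<in> ?MX\<close> by simp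
      qed
      obtain x b where x: "x \<in> X" and b: "b \<in> B" "b \<notin> Y" using XY by blast
      have "(x, b) \<in> (adjacent G)\<^sup>*" using conn x b XY(1) by (auto simp: verts)
      then have "b \<in> X \<union> Y"
      proof induction
        case (step y z)
        then obtain e where e: "e \<in> edges G" "ends G e = {y, z}" by (auto simp: adjacent_def)
        have "l e \<in> X \<longleftrightarrow> r e \<in> Y" using fwd bwd e(1) by blast
        moreover have "l e \<in> X \<union> Y \<longleftrightarrow> l e \<in> X" "r e \<in> X \<union> Y \<longleftrightarrow> r e \<in> Y"
          using l_in[OF e(1)] r_in[OF e(1)] XY disjoint by auto
        moreover have "{y, z} = {l e, r e}" using ends e by simp
        ultimately show ?case using step.IH by (metis doubleton_eq_iff)
      qed (use x in simp)
      then show False using b XY disjoint by auto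
    qed
  qed (use finite l_in r_in cardAB card4 card_verts in auto)
qed

text \<open>For connectedness, no edge joins the component \<open>K\<close> of \<open>u\<close> to
  its complement. If \<open>K\<close> is not everything, \<open>surplus\<close> for \<open>K\<close>
  or for its complement makes one side of \<open>K\<close> smaller than the other, and then applies
  the other way round as well.\<close>

lemma elementary_imp_matching_covered:
  assumes el: "elementary A B (edges G) l r"
  shows "matching_covered G"
proof -
  interpret el: elementary A B "edges G" l r by fact
  have "(u, v) \<in> (adjacent G)\<^sup>*" if uv: "u \<in> verts G" "v \<in> verts G" for u v
  proof -
    define K where "K = {v. (u, v) \<in> (adjacent G)\<^sup>*}"
    define X where "X = A \<inter> K"
    define Y where "Y = B \<inter> K"
    have sub: "X \<subseteq> A" "Y \<subseteq> B" by (simp_all add: X_def Y_def)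
    have both: "l e \<in> K \<longleftrightarrow> r e \<in> K" if e: "e \<in> edges G" for e
    proof -
      have "(l e, r e) \<in> adjacent G" "(r e, l e) \<in> adjacent G"
        using ends[OF e] e by (auto simp: adjacent_def insert_commute)
      then show ?thesis by (auto simp: K_def intro: rtrancl.rtrancl_into_rtrancl)
    qed
    have cards: "card (A - X) + card X = card A" "card (B - Y) + card Y = card A"
      using sub finite el.card_eq card_mono[of A X] card_mono[of B Y]
      by (simp_all add: card_Diff_subset finite_subset)
    have lvX: "leaving (edges G) l r X Y = {}"
      using both r_in by (auto simp: leaving_def X_def Y_def)
    have lvA: "leaving (edges G) l r (A - X) (B - Y) = {}"
      using both r_in by (auto simp: leaving_def X_def Y_def)
    have out: "card X < card Y" if "X \<noteq> {}" "Y \<noteq> B"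
      using el.surplus[OF sub that lvX] .
    have inn: "card Y < card X" if "X \<noteq> A" "Y \<noteq> {}"
    proof -
      have "A - X \<noteq> {}" "B - Y \<noteq> B" using that sub by blast+
      then have "card (A - X) < card (B - Y)" using el.surplus lvA by (metis Diff_subset)
      then show ?thesis using cards by linarith
    qed
    have ne: "A \<noteq> {}" "B \<noteq> {}" using el.card_ge el.card_eq by auto
    have "u \<in> K" by (simp add: K_def)
    then have "X \<noteq> {} \<or> Y \<noteq> {}" using uv(1) by (auto simp: verts X_def Y_def)
    moreover have "X = {} \<or> Y = B"
    proof (rule ccontr)
      assume "\<not> ?thesis"
      then have lt: "card X < card Y" using out by blast
      then have "Y \<noteq> {}" "X \<noteq> A" using cards by auto
      then show False using inn lt by simp
    qed
    moreover have "X = A \<or> Y = {}"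
    proof (rule ccontr)
      assume "\<not> ?thesis"
      then have lt: "card Y < card X" using inn by blast
      then have "X \<noteq> {}" "Y \<noteq> B" using cards by auto
      then show False using out lt by simp
    qed
    ultimately have "X = A \<and> Y = B" using ne by blast
    then show ?thesis using uv(2) by (auto simp: verts X_def Y_def K_def)
  qed
  moreover have "verts G \<noteq> {}" using el.card_ge by (auto simp: verts)
  ultimately have "connected_graph G" by (simp add: connected_graph_def)
  moreover have "4 \<le> card (verts G)" using card_verts el.card_eq el.card_ge by simp
  moreover have "\<exists>M. perfect_matching G M \<and> e \<in> M" if "e \<in> edges G" for e
    using el.perfect_matching_ex[OF that] perfect_matching_iff by metis
  ultimately show ?thesis
    using multigraph by (simp add: matching_covered_def)
qed

lemma delete: "bipartite_graph (delete_edge G e) A B l r"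
  using multigraph verts disjoint l_in r_in ends
  by unfold_locales (auto simp: delete_edge_def multigraph_def)

text \<open>If \<open>surplus\<close> fails at a pair once \<open>e\<close> is deleted, then
  \<open>e\<close> alone leaves that pair, and \<open>card_lt_leaving\<close> forces equal sizes:
  the pair is tight.\<close>

lemma minimal_imp_minimal_elementary:
  assumes "minimal_matching_covered G"
  shows "minimal_elementary A B (edges G) l r"
proof -
  have mc: "matching_covered G" and min: "\<And>e. e \<in> edges G \<Longrightarrow> \<not> matching_covered (delete_edge G e)"
    using assms by (auto simp: minimal_matching_covered_def)
  interpret el: elementary A B "edges G" l r by (rule matching_covered_imp_elementary[OF mc])
  show ?thesis
  proof unfold_locales
    fix e assume e: "e \<in> edges G"
    interpret d: bipartite_graph "delete_edge G e" A B l r by (rule delete)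
    have edges_d: "edges (delete_edge G e) = edges G - {e}" by (simp add: delete_edge_def)
    show "\<exists>X Y. tight A B (edges G) l r e X Y"
    proof (rule ccontr)
      assume no: "\<nexists>X Y. tight A B (edges G) l r e X Y"
      have "elementary A B (edges G - {e}) l r"
      proof unfold_locales
        fix X Y
        assume XY: "X \<subseteq> A" "Y \<subseteq> B" "X \<noteq> {}" "Y \<noteq> B" "leaving (edges G - {e}) l r X Y = {}"
        show "card X < card Y"
        proof (rule ccontr)
          assume le: "\<not> card X < card Y"
          have "leaving (edges G) l r X Y \<subseteq> {e}" using XY(5) by (auto simp: leaving_def)
          moreover have "leaving (edges G) l r X Y \<noteq> {}" using el.surplus XY(1-4) le by blast
          ultimately have lv: "leaving (edges G) l r X Y = {e}" by blast
          then have "card X = card Y" using el.card_lt_leaving[OF XY(1-4)] le by simp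
          then show False using no lv XY(1,2) unfolding tight_def by blast
        qed
      qed (use el.finite_A el.finite_B el.finite_E l_in r_in el.card_eq el.card_ge in auto)
      then have "matching_covered (delete_edge G e)"
        using d.elementary_imp_matching_covered edges_d by simp
      then show False using min e by blast
    qed
  qed
qed

text \<open>Deleting an edge at a vertex of degree two leaves a vertex of degree one. This gives the
  minimality of the example below.\<close>

lemma minimal_if_deg_2:
  assumes mc: "matching_covered G"
    and d2: "\<And>e. e \<in> edges G \<Longrightarrow> deg (edges G) l (l e) = 2 \<or> deg (edges G) r (r e) = 2"
  shows "minimal_matching_covered G"
  unfolding minimal_matching_covered_def
proof (intro conjI ballI mc notI)
  fix e assume e: "e \<in> edges G" and mc': "matching_covered (delete_edge G e)"
  interpret d: bipartite_graph "delete_edge G e" A B l r by (rule delete)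
  interpret el: elementary A B "edges (delete_edge G e)" l r
    by (rule d.matching_covered_imp_elementary[OF mc'])
  have "deg (edges (delete_edge G e)) f (f e) = deg (edges G) f (f e) - 1" for f :: "'e \<Rightarrow> 'v"
  proof -
    have "{g \<in> edges (delete_edge G e). f g = f e} = {g \<in> edges G. f g = f e} - {e}"
      by (auto simp: delete_edge_def)
    then show ?thesis using e by (simp add: deg_def)
  qed
  then show False
    using d2[OF e] el.deg_l_ge_2[of "l e"] el.deg_r_ge_2[of "r e"] l_in[OF e] r_in[OF e] by fastforce
qed

end

lemma bipartite_graph_ex:
  assumes "multigraph G" "bipartite G"
  shows "\<exists>A B l r. bipartite_graph G A B l r"
proof -
  obtain A B where AB: "A \<union> B = verts G" "A \<inter> B = {}"
    "\<forall>e\<in>edges G. \<exists>a\<in>A. \<exists>b\<in>B. ends G e = {a, b}"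
    using assms(2) by (auto simp: bipartite_def)
  then obtain l r where "\<forall>e\<in>edges G. l e \<in> A \<and> r e \<in> B \<and> ends G e = {l e, r e}"
    by metis
  then have "bipartite_graph G A B l r"
    using assms(1) AB by unfold_locales auto
  then show ?thesis by blast
qed

section \<open>Extremal graphs\<close>

context elementary
begin

lemma card_E_ge: "2 * card A \<le> card E"
proof -
  have "(\<Sum>a\<in>A. 2) \<le> (\<Sum>a\<in>A. deg E l a)" by (intro sum_mono deg_l_ge_2)
  then show ?thesis using card_E_l by simp
qed

lemma deg_l_eq_2:
  assumes "card E = 2 * card A" "a \<in> A"
  shows "deg E l a = 2"
proof (rule ccontr)
  assume "deg E l a \<noteq> 2"
  then have "2 < deg E l a" using deg_l_ge_2[OF assms(2)] by simp
  then have "(\<Sum>a\<in>A. 2) < (\<Sum>a\<in>A. deg E l a)"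
    using assms(2) finite_A deg_l_ge_2 by (intro sum_strict_mono_ex1) auto
  then show False using card_E_l assms(1) by simp
qed

lemma num_deg2_cycle:
  assumes "card E = 2 * card A"
  shows "num_deg2 A B E l r = 2 * card A"
proof -
  interpret s: elementary B A E r l by (rule elementary_swap) unfold_locales
  have "{a \<in> A. deg E l a = 2} = A" using deg_l_eq_2[OF assms] by auto
  moreover have "{b \<in> B. deg E r b = 2} = B" using s.deg_l_eq_2 assms card_eq by auto
  ultimately show ?thesis using card_eq by (simp add: num_deg2_def)
qed

end

text \<open>Both vertices of \<open>A\<close> have degree two and there are no parallel edges, so
  the graph is complete bipartite.\<close>

lemma (in bipartite_graph) isomorphic_C4:
  assumes me: "minimal_elementary A B (edges G) l r" and cA: "card A = 2" and cE: "card (edges G) = 4"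
  shows "isomorphic G C4"
proof -
  interpret me: minimal_elementary A B "edges G" l r by fact
  have joined: "\<exists>e\<in>edges G. l e = a \<and> r e = b" if "a \<in> A" "b \<in> B" for a b
  proof -
    let ?S = "{e \<in> edges G. l e = a}"
    have "card ?S = 2" using me.deg_l_eq_2[of a] that cA cE by (simp add: deg_def)
    moreover have "inj_on r ?S" using me.no_parallel by (auto intro!: inj_onI)
    ultimately have "card (r ` ?S) = card B" using card_image[of r ?S] me.card_eq cA by simp
    then have "r ` ?S = B" using finite(2) r_in by (intro card_seteq) auto
    then show ?thesis using that by blast
  qed
  obtain a0 a1 where A: "A = {a0, a1}" "a0 \<noteq> a1" using cA by (auto simp: card_2_iff)
  have "card B = 2" using me.card_eq cA by simp
  then obtain b0 b1 where B: "B = {b0, b1}" "b0 \<noteq> b1" by (auto simp: card_2_iff)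
  have AB: "a0 \<noteq> b0" "a0 \<noteq> b1" "a1 \<noteq> b0" "a1 \<noteq> b1" using disjoint A B by auto
  obtain e0 where e0: "e0 \<in> edges G" "l e0 = a0" "r e0 = b0" using joined[of a0 b0] A B by blast
  obtain e1 where e1: "e1 \<in> edges G" "l e1 = a1" "r e1 = b0" using joined[of a1 b0] A B by blast
  obtain e2 where e2: "e2 \<in> edges G" "l e2 = a1" "r e2 = b1" using joined[of a1 b1] A B by blast
  obtain e3 where e3: "e3 \<in> edges G" "l e3 = a0" "r e3 = b1" using joined[of a0 b1] A B by blast
  have ne: "e0 \<noteq> e1" "e0 \<noteq> e2" "e0 \<noteq> e3" "e1 \<noteq> e2" "e1 \<noteq> e3" "e2 \<noteq> e3"
    using e0 e1 e2 e3 A B by auto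
  have "{e0, e1, e2, e3} = edges G"
    using finite(3) e0 e1 e2 e3 ne cE by (intro card_seteq) auto
  then have E: "edges G = {e0, e1, e2, e3}" by simp
  \<comment> \<open>The numbering follows the cycle \<open>a0\<close>, \<open>b0\<close>,
    \<open>a1\<close>, \<open>b1\<close>, so that edge \<open>i\<close> joins vertices
    \<open>i\<close> and \<open>i + 1\<close> modulo 4.\<close>
  define f where "f v = (if v = a0 then 0 else if v = b0 then 1 else if v = a1 then 2 else 3 :: nat)" for v
  define g where "g e = (if e = e0 then 0 else if e = e1 then 1 else if e = e2 then 2 else 3 :: nat)" for e
  have four: "{0..<4} = {0, 1, 2, 3 :: nat}" by auto
  have "bij_betw f (verts G) (verts C4)"
    using AB A(2) B(2) by (auto simp: bij_betw_def inj_on_def f_def verts A(1) B(1) C4_def four)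
  moreover have "bij_betw g (edges G) (edges C4)"
    using ne by (auto simp: bij_betw_def inj_on_def g_def E C4_def four)
  moreover have "ends C4 (g e) = f ` ends G e" if "e \<in> edges G" for e
  proof -
    have f: "f a0 = 0" "f b0 = 1" "f a1 = 2" "f b1 = 3"
      using AB A(2) B(2) by (simp_all add: f_def)
    have g: "g e0 = 0" "g e1 = 1" "g e2 = 2" "g e3 = 3" using ne by (simp_all add: g_def)
    have "ends G e0 = {a0, b0}" "ends G e1 = {a1, b0}" "ends G e2 = {a1, b1}" "ends G e3 = {a0, b1}"
      using ends e0 e1 e2 e3 by simp_all
    with that show ?thesis unfolding E by (auto simp: f g C4_def)
  qed
  ultimately show ?thesis unfolding isomorphic_def by blast
qed

lemma (in bipartite_graph) mn2_eq:
  assumes "card A = card B"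
  shows "mn2 G = int (card (edges G)) - 2 * int (card A) + 2"
  using card_verts assms by (simp add: mn2_def)

text \<open>If \<open>card (edges G) = 2 * card A\<close>, all degrees are two and extremality
  forces \<open>card A = 2\<close>, hence \<open>C4\<close>. Otherwise the equality clause of
  \<open>num_deg2_bound\<close> applies.\<close>

lemma H2_subset_H0: "H2 - {G. isomorphic G C4} \<subseteq> H0"
proof
  fix G :: "('v, 'e) mgraph" assume G: "G \<in> H2 - {G. isomorphic G C4}"
  then have min: "minimal_matching_covered G" and bip: "bipartite G"
    and ext: "int (card (V2 G)) = 2 * mn2 G" and nC4: "\<not> isomorphic G C4"
    by (auto simp: H2_def)
  have "multigraph G" using min by (simp add: minimal_matching_covered_def matching_covered_def)
  then obtain A B l r where "bipartite_graph G A B l r" using bipartite_graph_ex bip by blast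
  then interpret bipartite_graph G A B l r .
  interpret me: minimal_elementary A B "edges G" l r
    by (rule minimal_imp_minimal_elementary[OF min])
  have n: "num_deg2 A B (edges G) l r + 4 * card A = 2 * (card (edges G) + 2)"
    using ext mn2_eq[OF me.card_eq] card_V2 by simp
  have "card (edges G) \<noteq> 2 * card A"
  proof
    assume c: "card (edges G) = 2 * card A"
    then have "card A = 2" using n me.num_deg2_cycle by simp
    then show False using isomorphic_C4[OF me.minimal_elementary_axioms] c nC4 by simp
  qed
  then have "2 * card A < card (edges G)" using me.card_E_ge by simp
  then have "num_edges2 (edges G) l r + 2 * card A = card (edges G) + 2"
    using num_deg2_bound[OF me.minimal_elementary_axioms] n by blast
  then have "int (card (E2 G)) = mn2 G" using mn2_eq[OF me.card_eq] card_E2 by simp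
  then show "G \<in> H0" using min bip by (simp add: H0_def)
qed

section \<open>A graph in \<open>H0\<close> but not in \<open>H2\<close>\<close>

text \<open>The example is evaluated over \<open>nat\<close> and carried into arbitrary infinite
  types by injections; \<open>inv s\<close> recovers the number of an edge.\<close>

lemma elementary_image:
  assumes el: "elementary A B E l r" and p: "inj p" and s: "inj s"
  shows "elementary (p ` A) (p ` B) (s ` E) (\<lambda>e. p (l (inv s e))) (\<lambda>e. p (r (inv s e)))"
proof -
  interpret elementary A B E l r by fact
  have card_p: "card (p ` X) = card X" for X using p by (intro card_image) (rule inj_on_subset, auto)
  show ?thesis
  proof unfold_locales
    fix X Y
    assume XY: "X \<subseteq> p ` A" "Y \<subseteq> p ` B" "X \<noteq> {}" "Y \<noteq> p ` B"
      and clo: "leaving (s ` E) (\<lambda>e. p (l (inv s e))) (\<lambda>e. p (r (inv s e))) X Y = {}"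
    obtain X' Y' where X': "X' \<subseteq> A" "X = p ` X'" and Y': "Y' \<subseteq> B" "Y = p ` Y'"
      using XY(1,2) by (auto simp: subset_image_iff)
    have "e \<notin> leaving E l r X' Y'" for e
    proof -
      have "s e \<notin> leaving (s ` E) (\<lambda>e. p (l (inv s e))) (\<lambda>e. p (r (inv s e))) X Y"
        using clo by blast
      then show ?thesis using p s X'(2) Y'(2) by (auto simp: leaving_def inj_image_mem_iff)
    qed
    then have "leaving E l r X' Y' = {}" by blast
    then have "card X' < card Y'" using surplus[of X' Y'] X' Y' XY by auto
    then show "card X < card Y" using card_p X' Y' by simp
  qed (use finite_A finite_B finite_E l_in r_in card_eq card_ge card_p s in auto)
qed

lemma deg_image:
  assumes "inj p" "inj s"
  shows "deg (s ` E) (\<lambda>e. p (f (inv s e))) (p v) = deg E f v"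
proof -
  have "{e \<in> s ` E. p (f (inv s e)) = p v} = s ` {e \<in> E. f e = v}"
    using assms by (auto simp: inj_eq)
  then show ?thesis using card_image[OF inj_on_subset[OF assms(2)]] by (simp add: deg_def)
qed

text \<open>Four paths of length three join the vertex 0 to two vertices 6 and 7, and a further path of
  length two joins 6 to 7. The last path adds a vertex of degree two but no edge between two such
  vertices, so the graph meets the bound on edges but not the one on vertices.\<close>

definition left_ends :: "nat list" where "left_ends = [0,0,0,0,1,2,3,4,1,2,3,4,5,5]"
definition right_ends :: "nat list" where "right_ends = [8,9,10,11,8,9,10,11,6,6,7,7,6,7]"

theorem corollary4p2:
  shows "H2 - {G. isomorphic G C4} \<subset> (H0 :: ('v::infinite, 'e::infinite) mgraph set)"
proof -
  let ?A = "{0..<6::nat}" and ?B = "{6..<12::nat}" and ?E = "{0..<14::nat}"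
  let ?L = "(!) left_ends" and ?R = "(!) right_ends"
  have left_less: "\<forall>e\<in>?E. ?L e \<in> ?A" and right_less: "\<forall>e\<in>?E. ?R e \<in> ?B"
    by code_simp+
  have range_right: "?R ` ?E = ?B" by code_simp
  \<comment> \<open>Testing neighbourhoods of proper subsets suffices: a \<open>Y\<close> that no
    edge leaves contains the neighbourhood of \<open>X\<close>, and that of \<open>?A\<close> is all
    of \<open>?B\<close>.\<close>
  have surplus: "\<forall>X\<in>Pow ?A. X \<noteq> {} \<longrightarrow> X \<noteq> ?A \<longrightarrow> card X < card (?R ` {e \<in> ?E. ?L e \<in> X})"
    by code_simp
  have degs: "\<forall>e\<in>?E. deg ?E ?L (?L e) = 2 \<or> deg ?E ?R (?R e) = 2" by code_simp
  have num_deg2: "num_deg2 ?A ?B ?E ?L ?R = 9" by code_simp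
  have num_edges2: "num_edges2 ?E ?L ?R = 4" by code_simp
  have el_nat: "elementary ?A ?B ?E ?L ?R"
  proof unfold_locales
    fix X Y :: "nat set"
    assume XY: "X \<subseteq> ?A" "Y \<subseteq> ?B" "X \<noteq> {}" "Y \<noteq> ?B"
      and clo: "leaving ?E ?L ?R X Y = {}"
    have sub: "?R ` {e \<in> ?E. ?L e \<in> X} \<subseteq> Y" using clo by (auto simp: leaving_def)
    have "X \<noteq> ?A"
    proof
      assume X: "X = ?A"
      have "{e \<in> ?E. ?L e \<in> X} = ?E" unfolding X using left_less by blast
      then have "?B \<subseteq> Y" using sub range_right by simp
      then show False using XY by blast
    qed
    then have "card X < card (?R ` {e \<in> ?E. ?L e \<in> X})"
      using surplus XY(1,3) by blast
    also have "\<dots> \<le> card Y" using sub XY(2) by (intro card_mono) (auto intro: finite_subset)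
    finally show "card X < card Y" .
  qed (use left_less right_less in auto)
  obtain p :: "nat \<Rightarrow> 'v" where p: "inj p" using infinite_countable_subset[OF infinite_UNIV] by blast
  obtain s :: "nat \<Rightarrow> 'e" where s: "inj s" using infinite_countable_subset[OF infinite_UNIV] by blast
  define l where "l = (\<lambda>e. p (?L (inv s e)))"
  define r where "r = (\<lambda>e. p (?R (inv s e)))"
  define A where "A = p ` ?A"
  define B where "B = p ` ?B"
  define E where "E = s ` ?E"
  define G where "G = \<lparr>verts = A \<union> B, edges = E, ends = (\<lambda>e. {l e, r e})\<rparr>"
  have sel: "verts G = A \<union> B" "edges G = E" "\<And>e. ends G e = {l e, r e}"
    by (simp_all add: G_def)
  have lE: "l e \<in> A" and rE: "r e \<in> B" if "e \<in> E" for e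
    using that left_less right_less s by (auto simp: l_def r_def A_def B_def E_def)
  have disj: "A \<inter> B = {}" using p by (auto simp: inj_eq A_def B_def)
  have "bipartite_graph G A B l r"
  proof unfold_locales
    have "l e \<noteq> r e" if "e \<in> E" for e using lE[OF that] rE[OF that] disj by auto
    then have "card (ends G e) = 2" if "e \<in> E" for e using that by (simp add: sel)
    moreover have "ends G e \<subseteq> verts G" if "e \<in> E" for e
      using lE[OF that] rE[OF that] by (simp add: sel)
    moreover have "finite (verts G)" "finite (edges G)" by (simp_all add: sel A_def B_def E_def)
    ultimately show "multigraph G" by (simp add: multigraph_def sel(2))
  qed (use sel lE rE disj in simp_all)
  then interpret bipartite_graph G A B l r .
  have el: "elementary A B (edges G) l r"
    using elementary_image[OF el_nat p s]
    by (simp only: sel A_def B_def E_def l_def r_def)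
  have deg_l: "deg E l (p v) = deg ?E ?L v" and deg_r: "deg E r (p v) = deg ?E ?R v" for v
    unfolding E_def l_def r_def by (rule deg_image[OF p s])+
  have ends_s: "l (s i) = p (?L i)" "r (s i) = p (?R i)" for i
    using s by (simp_all add: l_def r_def)
  have min: "minimal_matching_covered G"
  proof (rule minimal_if_deg_2[OF elementary_imp_matching_covered[OF el]])
    fix e assume "e \<in> edges G"
    then obtain i where "i \<in> ?E" "e = s i" by (auto simp: sel E_def)
    then show "deg (edges G) l (l e) = 2 \<or> deg (edges G) r (r e) = 2"
      using degs by (simp add: sel ends_s deg_l deg_r)
  qed
  have bip: "bipartite G"
    unfolding bipartite_def using verts disjoint l_in r_in ends by metis
  have inj_p: "inj_on p X" and inj_s: "inj_on s X'" for X X' using p s by (auto intro: inj_on_subset)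
  have "{a \<in> A. deg E l a = 2} = p ` {a \<in> ?A. deg ?E ?L a = 2}"
    "{b \<in> B. deg E r b = 2} = p ` {b \<in> ?B. deg ?E ?R b = 2}"
    by (auto simp: A_def B_def deg_l deg_r)
  then have "card (V2 G) = num_deg2 ?A ?B ?E ?L ?R"
    by (simp only: card_V2 sel num_deg2_def card_image[OF inj_p])
  then have V2: "card (V2 G) = 9" using num_deg2 by simp
  have "{e \<in> E. deg E l (l e) = 2 \<and> deg E r (r e) = 2}
      = s ` {e \<in> ?E. deg ?E ?L (?L e) = 2 \<and> deg ?E ?R (?R e) = 2}"
    by (auto simp: E_def ends_s deg_l[unfolded E_def] deg_r[unfolded E_def])
  then have "card (E2 G) = num_edges2 ?E ?L ?R"
    by (simp only: card_E2 sel num_edges2_def card_image[OF inj_s])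
  then have E2: "card (E2 G) = 4" using num_edges2 by simp
  have "card A = 6" "card B = 6" "card E = 14"
    by (simp_all add: A_def B_def E_def card_image[OF inj_p] card_image[OF inj_s])
  \<comment> \<open>Since \<open>14 - 12 + 2 = 4\<close>, the four edges are extremal, whereas
    membership in \<open>H2\<close> would require eight vertices of degree two, not nine.\<close>
  then have "mn2 G = 4" using mn2_eq by (simp add: sel)
  then have "G \<in> H0" "G \<notin> H2" using min bip V2 E2 by (simp_all add: H0_def H2_def)
  then show ?thesis using H2_subset_H0 by blast
qed

end
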